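(* For all integers $a\geqslant0$, $b\geqslant0$, with $k=2a+2b+3$, $$\begin{aligned}\sigma(\underbrace{2,\ldots,2}_a,3,\underbrace{2,\ldots,2}_b)&=-\sum_{r=\max(a,1)}^{a+b+1}\binom{2r}{2a}\frac{(\pi/3)^{k-1-2r}}{(k-1-2r)!}(-1)^r(1-2^{-2r})(1-3^{-2r})\zeta(2r+1)\\&-\sum_{r=a+1}^{a+b+1}\binom{2r-1}{2a}\frac{(\pi/3)^{k-2r}}{(k-2r)!}(-1)^r\sqrt3\,(1+2^{1-2r})L(2r,\chi)\\&+\sum_{r=b+1}^{a+b+1}\binom{2r}{2b+2}\frac{(\pi/3)^{k-1-2r}}{(k-1-2r)!}\,2(-1)^r\zeta(2r+1).\end{aligned}$$
   Context: For a composition $(a_1,\ldots,a_r)$ of positive integers, $\sigma(a_1,\ldots,a_r)=\sum_{n_1>\cdots>n_r>0}\binom{2n_1}{n_1}^{-1}n_1^{-a_1}\cdots n_r^{-a_r}$. $\zeta(s)$ is the Riemann zeta function, $\chi$ is the non-principal Dirichlet character modulo $3$, and $L(s,\chi)=\sum_{n\geqslant1}\chi(n)n^{-s}$. *)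

theory Defs
  imports "HOL-Analysis.Analysis"
begin

definition decreasing_tuples :: "nat \<Rightarrow> nat list set" where
  "decreasing_tuples r = {ns. length ns = r \<and> sorted_wrt (>) ns \<and> (\<forall>n\<in>set ns. 0 < n)}"

text \<open>
  The multiple sum has nonnegative terms, so the unordered sum is the usual one. Only nonempty
  compositions are meaningful, since the binomial coefficient involves the largest index.
\<close>
definition binom_sigma :: "nat list \<Rightarrow> real" where
  "binom_sigma as = (\<Sum>\<^sub>\<infinity>ns\<in>decreasing_tuples (length as).
     1 / real ((2 * hd ns) choose hd ns) * (\<Prod>i<length as. 1 / real (ns ! i) ^ (as ! i)))"

text \<open>
  The Riemann zeta function and Dirichlet L-series at integer arguments, given by their Dirichlet
  series; these are the intended values for all \<open>s \<ge> 2\<close>.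
\<close>
definition zeta :: "nat \<Rightarrow> real" where
  "zeta s = (\<Sum>n. 1 / real (Suc n) ^ s)"

definition dirichlet_L :: "nat \<Rightarrow> (nat \<Rightarrow> real) \<Rightarrow> real" where
  "dirichlet_L s f = (\<Sum>n. f (Suc n) / real (Suc n) ^ s)"

definition dirichlet_character :: "nat \<Rightarrow> (nat \<Rightarrow> complex) \<Rightarrow> bool" where
  "dirichlet_character m f \<longleftrightarrow>
     (\<forall>n. f (n + m) = f n) \<and> (\<forall>n k. f (n * k) = f n * f k) \<and> (\<forall>n. f n = 0 \<longleftrightarrow> \<not> coprime n m)"

definition principal_character :: "nat \<Rightarrow> nat \<Rightarrow> complex" where
  "principal_character m n = (if coprime n m then 1 else 0)"

definition chi3 :: "nat \<Rightarrow> real" where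
  "chi3 n = (if n mod 3 = 1 then 1 else if n mod 3 = 2 then -1 else 0)"

lemma coprime_3_iff: "coprime n 3 \<longleftrightarrow> n mod 3 \<noteq> 0" for n :: nat
proof -
  have "coprime 3 (n mod 3) \<longleftrightarrow> n mod 3 \<noteq> 0"
  proof -
    consider "n mod 3 = 0" | "n mod 3 = 1" | "n mod 3 = 2" by linarith
    then show ?thesis by cases (simp_all add: coprime_iff_gcd_eq_1 gcd_non_0_nat)
  qed
  then show ?thesis
    by (metis coprime_commute coprime_mod_right_iff zero_neq_numeral)
qed

text \<open>\<^const>\<open>chi3\<close> is the unique non-principal Dirichlet character modulo 3.\<close>
lemma nonprincipal_character_3_iff:
  "dirichlet_character 3 f \<and> f \<noteq> principal_character 3 \<longleftrightarrow> f = (\<lambda>n. complex_of_real (chi3 n))"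
proof
  assume A: "dirichlet_character 3 f \<and> f \<noteq> principal_character 3"
  then have per: "f (n + 3) = f n" and mult: "f (n * k) = f n * f k"
    and zero: "f n = 0 \<longleftrightarrow> n mod 3 = 0" for n k
    by (auto simp: dirichlet_character_def coprime_3_iff)
  have "f (n + 3 * q) = f n" for n q
  proof (induction q)
    case (Suc q)
    then show ?case using per[of "n + 3 * q"] by (simp add: algebra_simps)
  qed simp
  then have md: "f n = f (n mod 3)" for n
    by (metis mod_mult_div_eq)
  have "f 1 * f 1 = f 1" using mult[of 1 1] by simp
  moreover have "f 1 \<noteq> 0" using zero[of 1] by simp
  ultimately have one: "f 1 = 1" by simp
  have "f 2 * f 2 = 1" using mult[of 2 2] md[of 4] one by simp
  then have "f 2 = 1 \<or> f 2 = -1"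
    by (metis square_eq_1_iff)
  moreover have "f 2 \<noteq> 1"
  proof
    assume two: "f 2 = 1"
    have "f n = principal_character 3 n" for n
    proof -
      consider "n mod 3 = 0" | "n mod 3 = 1" | "n mod 3 = 2" by linarith
      then show ?thesis
        using md[of n] one two zero[of n]
        by cases (auto simp: principal_character_def coprime_3_iff)
    qed
    with A show False by auto
  qed
  ultimately have two: "f 2 = -1" by simp
  show "f = (\<lambda>n. complex_of_real (chi3 n))"
  proof
    fix n :: nat
    consider "n mod 3 = 0" | "n mod 3 = 1" | "n mod 3 = 2" by linarith
    then show "f n = complex_of_real (chi3 n)"
      using md[of n] one two zero[of n] by cases (auto simp: chi3_def)
  qed
next
  assume eq: "f = (\<lambda>n. complex_of_real (chi3 n))"
  have "chi3 (n * k) = chi3 n * chi3 k" for n k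
  proof -
    have m: "n * k mod 3 = (n mod 3) * (k mod 3) mod 3" by (simp add: mod_mult_eq)
    have "n mod 3 = 0 \<or> n mod 3 = 1 \<or> n mod 3 = 2" "k mod 3 = 0 \<or> k mod 3 = 1 \<or> k mod 3 = 2"
      by linarith+
    then show ?thesis by (auto simp: chi3_def m)
  qed
  moreover have "chi3 n = 0 \<longleftrightarrow> \<not> coprime n 3" for n
    by (auto simp: chi3_def coprime_3_iff)
  moreover have "chi3 (n + 3) = chi3 n" for n
    by (simp add: chi3_def)
  ultimately have "dirichlet_character 3 f"
    by (simp add: dirichlet_character_def eq)
  moreover have "f 2 \<noteq> principal_character 3 2"
    by (simp add: eq chi3_def principal_character_def)
  ultimately show "dirichlet_character 3 f \<and> f \<noteq> principal_character 3" by auto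
qed

end

theory Submission
  imports Defs
begin

text \<open>
  Put \<open>\<theta> = \<pi>/3\<close> and \<open>G\<^sub>n(t) = (2 sin(t/2))\<^sup>2\<^sup>n / binom(2n, n)\<close>, so that \<open>G\<^sub>n(\<theta>) = 1 / binom(2n, n)\<close>.
  Since \<open>G\<^sub>n'' = n\<^sup>2 (G\<^sub>n\<^sub>-\<^sub>1 - G\<^sub>n)\<close>, every entry \<open>2\<close> of the composition amounts to integrating twice
  from \<open>0\<close>, and since \<open>G\<^sub>n' = n cot(t/2) G\<^sub>n\<close>, the entry \<open>3\<close> contributes one extra integration
  against \<open>cot(t/2)\<close>. Hence the sum equals the integral of \<open>p(t) cot(t/2)\<close> over \<open>[0, \<theta>]\<close>, where
  \<open>p(t) = (\<theta> - t)\<^sup>2\<^sup>a / (2a)! * t\<^sup>2\<^sup>b\<^sup>+\<^sup>2 / (2b+2)!\<close>. Integrating by parts against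
  \<open>ln(2 sin(t/2)) = - \<Sum> cos(nt)/n\<close> reduces this to the derivatives of \<open>p\<close> at the endpoints and to the
  polylogarithms \<open>Li\<^sub>s(1)\<close> and \<open>Li\<^sub>s(e\<^sup>i\<^sup>\<theta>)\<close>, which are zeta and L-values.
\<close>

section \<open>Multiple harmonic sums\<close>

text \<open>The part of the multiple sum that remains once the largest index has been fixed as
  \<open>n\<close>; the strict bound \<open>m < n\<close> encodes the decreasing order of the
  indices.\<close>

fun multiple_harmonic_sum :: "nat list \<Rightarrow> nat \<Rightarrow> real" where
  "multiple_harmonic_sum [] n = 1"
| "multiple_harmonic_sum (x # xs) n = (\<Sum>m = 1..<n. multiple_harmonic_sum xs m / real m ^ x)"

definition decreasing_tuples_below :: "nat \<Rightarrow> nat \<Rightarrow> nat list set" where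
  "decreasing_tuples_below r n = {ns \<in> decreasing_tuples r. \<forall>m\<in>set ns. m < n}"

lemma finite_decreasing_tuples_below: "finite (decreasing_tuples_below r n)"
  by (rule finite_subset[of _ "{ns. set ns \<subseteq> {..<n} \<and> length ns = r}"])
     (auto simp: decreasing_tuples_below_def decreasing_tuples_def intro: finite_lists_length_eq)

lemma decreasing_tuples_Suc:
  "decreasing_tuples (Suc r) = (\<lambda>(n, ns). n # ns) ` Sigma {0<..} (decreasing_tuples_below r)"
  by (force simp: decreasing_tuples_def decreasing_tuples_below_def length_Suc_conv)

lemma decreasing_tuples_below_Suc:
  "decreasing_tuples_below (Suc r) n =
     (\<lambda>(m, ns). m # ns) ` Sigma {1..<n} (decreasing_tuples_below r)"
  by (force simp: decreasing_tuples_def decreasing_tuples_below_def length_Suc_conv)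

lemma prod_nth_Cons:
  "(\<Prod>i<length (x # xs). 1 / real ((m # ns) ! i) ^ ((x # xs) ! i)) =
     1 / real m ^ x * (\<Prod>i<length xs. 1 / real (ns ! i) ^ (xs ! i))"
  by (simp only: length_Cons prod.lessThan_Suc_shift) simp

lemma multiple_harmonic_sum_eq_sum_tuples:
  "multiple_harmonic_sum xs n =
     (\<Sum>ns\<in>decreasing_tuples_below (length xs) n. \<Prod>i<length xs. 1 / real (ns ! i) ^ (xs ! i))"
proof (induction xs arbitrary: n)
  case Nil
  have "decreasing_tuples_below 0 n = {[]}"
    by (auto simp: decreasing_tuples_below_def decreasing_tuples_def)
  then show ?case by simp
next
  case (Cons x xs)
  have inj: "inj_on (\<lambda>(m, ns). m # ns) A" for A :: "(nat \<times> nat list) set"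
    by (auto simp: inj_on_def)
  have "(\<Sum>ns\<in>decreasing_tuples_below (length (x # xs)) n.
           \<Prod>i<length (x # xs). 1 / real (ns ! i) ^ ((x # xs) ! i))
      = (\<Sum>(m, ns)\<in>Sigma {1..<n} (decreasing_tuples_below (length xs)).
           1 / real m ^ x * (\<Prod>i<length xs. 1 / real (ns ! i) ^ (xs ! i)))"
    unfolding length_Cons[of x xs] decreasing_tuples_below_Suc
    by (subst sum.reindex[OF inj])
       (auto simp: prod_nth_Cons[unfolded length_Cons] simp del: prod.lessThan_Suc intro!: sum.cong)
  also have "\<dots> = (\<Sum>m = 1..<n. \<Sum>ns\<in>decreasing_tuples_below (length xs) m.
           1 / real m ^ x * (\<Prod>i<length xs. 1 / real (ns ! i) ^ (xs ! i)))"
    by (subst sum.Sigma) (auto simp: finite_decreasing_tuples_below)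
  also have "\<dots> = multiple_harmonic_sum (x # xs) n"
    by (simp add: Cons.IH sum_distrib_left sum_divide_distrib)
  finally show ?case by simp
qed

lemma multiple_harmonic_sum_nonneg: "multiple_harmonic_sum xs n \<ge> 0"
  by (induction xs arbitrary: n) (auto intro!: sum_nonneg)

text \<open>There are fewer summands than the bound allows and each is at most a power of
  \<open>n\<close>. Polynomial growth suffices, since it is set against the geometric growth of the
  central binomial coefficient.\<close>

lemma multiple_harmonic_sum_le: "multiple_harmonic_sum xs n \<le> real n ^ length xs"
proof (induction xs arbitrary: n)
  case (Cons x xs)
  have "multiple_harmonic_sum xs m / real m ^ x \<le> real n ^ length xs" if "m \<in> {1..<n}" for m
  proof -
    have "multiple_harmonic_sum xs m / real m ^ x \<le> multiple_harmonic_sum xs m / 1"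
      using that multiple_harmonic_sum_nonneg by (intro divide_left_mono) auto
    also have "\<dots> \<le> real m ^ length xs" using Cons.IH by simp
    also have "\<dots> \<le> real n ^ length xs" using that by (intro power_mono) auto
    finally show ?thesis .
  qed
  then have "multiple_harmonic_sum (x # xs) n \<le> of_nat (card {1..<n}) * real n ^ length xs"
    unfolding multiple_harmonic_sum.simps by (rule sum_bounded_above)
  also have "\<dots> \<le> real n * real n ^ length xs"
    by (intro mult_right_mono) auto
  finally show ?case by simp
qed simp

lemma multiple_harmonic_sum_Cons_Suc:
  "multiple_harmonic_sum (x # xs) (Suc n) =
     multiple_harmonic_sum (x # xs) n + (if n = 0 then 0 else multiple_harmonic_sum xs n / real n ^ x)"
  by simp

text \<open>For \<open>a\<^sub>1 \<ge> 1\<close> the coefficient at \<open>n = 0\<close> vanishes because \<open>x / 0 = 0\<close>.\<close>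

fun apery_coeff :: "nat list \<Rightarrow> nat \<Rightarrow> real" where
  "apery_coeff [] n = (if n = 0 then 1 else 0)"
| "apery_coeff (x # xs) n = multiple_harmonic_sum xs n / (real n ^ x * real ((2 * n) choose n))"

section \<open>Central binomial growth and convergence of the generating series\<close>

lemma central_binomial_Suc:
  "real (Suc n) * real ((2 * Suc n) choose Suc n) = (4 * real n + 2) * real ((2 * n) choose n)"
proof -
  have "Suc n * ((2 * Suc n) choose Suc n) = Suc (2 * n + 1) * ((2 * n + 1) choose n)"
    using Suc_times_binomial_eq[of "2 * n + 1" n] by (simp add: mult_ac)
  also have "(2 * n + 1) choose n = (2 * n + 1) choose Suc n"
    using binomial_symmetric[of n "2 * n + 1"] by simp
  also have "Suc (2 * n + 1) * \<dots> = 2 * (Suc n * (Suc (2 * n) choose Suc n))" by simp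
  also have "\<dots> = 2 * (Suc (2 * n) * ((2 * n) choose n))"
    by (simp only: Suc_times_binomial)
  finally have "real (Suc n * ((2 * Suc n) choose Suc n)) =
      real (2 * (Suc (2 * n) * ((2 * n) choose n)))" by (rule arg_cong)
  then have "real (Suc n) * real ((2 * Suc n) choose Suc n) =
      2 * (real (Suc (2 * n)) * real ((2 * n) choose n))"
    by (simp only: of_nat_mult of_nat_numeral)
  also have "\<dots> = (4 * real n + 2) * real ((2 * n) choose n)"
    by (simp add: algebra_simps)
  finally show ?thesis .
qed

text \<open>This is far below the true growth rate 4^n, but it gives convergence for |z| < 2, and
  the multiple sum itself sits at z = 1.\<close>

lemma central_binomial_ge_power2: "2 ^ n \<le> real ((2 * n) choose n)"
proof (induction n)
  case (Suc n)
  have "real (Suc n) * 2 ^ Suc n \<le> (4 * real n + 2) * real ((2 * n) choose n)"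
    unfolding power_Suc mult.assoc[symmetric] using Suc by (intro mult_mono) auto
  then have "real (Suc n) * 2 ^ Suc n \<le> real (Suc n) * real ((2 * Suc n) choose Suc n)"
    by (simp only: central_binomial_Suc)
  then show ?case
    by (rule mult_left_le_imp_le) simp
qed simp

text \<open>Termwise differentiation followed by multiplication by \<open>r\<close> supplies one
  more factor \<open>n\<close>, so induction on \<open>k\<close> starts from the geometric
  series.\<close>

lemma summable_power_times_geometric:
  fixes r :: real
  assumes "\<bar>r\<bar> < 1"
  shows "summable (\<lambda>n. real n ^ k * r ^ n)"
  using assms
proof (induction k arbitrary: r)
  case 0
  then show ?case by (simp add: summable_geometric)
next
  case (Suc k)
  have "summable (\<lambda>n. diffs (\<lambda>n. real n ^ k) n * r ^ n)"
    by (rule termdiff_converges[of r 1]) (use Suc in auto)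
  then have "summable (\<lambda>n. r * (diffs (\<lambda>n. real n ^ k) n * r ^ n))"
    by (rule summable_mult)
  then have "summable (\<lambda>n. real (Suc n) ^ Suc k * r ^ Suc n)"
    by (simp add: diffs_def mult_ac)
  then show ?case by (subst (asm) summable_Suc_iff)
qed

lemma summable_apery_coeff:
  fixes z :: real
  assumes "\<bar>z\<bar> < 2"
  shows "summable (\<lambda>n. apery_coeff xs n * z ^ n)"
proof (cases xs)
  case Nil
  have "summable (\<lambda>n. if n = 0 then 1 * z ^ n else 0)"
    by (rule summable_finite[of "{0}"]) auto
  then show ?thesis by (rule summable_cong[THEN iffD1, rotated]) (auto simp: Nil)
next
  case (Cons x ys)
  show ?thesis
  proof (rule summable_comparison_test', rule summable_power_times_geometric)
    show "\<bar>\<bar>z\<bar> / 2\<bar> < 1" using assms by simp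
    fix n :: nat
    assume n: "n \<ge> 1"
    let ?C = "real ((2 * n) choose n)"
    have "multiple_harmonic_sum ys n / (real n ^ x * ?C) \<le> real n ^ length ys / (1 * 2 ^ n)"
      using multiple_harmonic_sum_nonneg[of ys n] multiple_harmonic_sum_le[of ys n]
        central_binomial_ge_power2[of n] n
      by (intro frac_le mult_mono) auto
    then have "apery_coeff xs n * \<bar>z\<bar> ^ n \<le> real n ^ length ys / 2 ^ n * \<bar>z\<bar> ^ n"
      unfolding Cons by (intro mult_right_mono) auto
    moreover have "apery_coeff xs n \<ge> 0"
      by (simp add: Cons multiple_harmonic_sum_nonneg)
    ultimately show "norm (apery_coeff xs n * z ^ n) \<le> real n ^ length ys * (\<bar>z\<bar> / 2) ^ n"
      by (simp add: abs_mult power_abs power_divide)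
  qed
qed

text \<open>Tuples are grouped by their largest entry \<open>n\<close>. Each fibre is finite and
  sums to the coefficient at \<open>n\<close>, and nonnegativity justifies regrouping the unordered
  sum.\<close>

lemma binom_sigma_eq_suminf:
  assumes "x > 0"
  shows "binom_sigma (x # xs) = (\<Sum>n. apery_coeff (x # xs) n)"
proof -
  let ?f = "\<lambda>ns. 1 / real ((2 * hd ns) choose hd ns) *
              (\<Prod>i<length (x # xs). 1 / real (ns ! i) ^ ((x # xs) ! i))"
  have nn: "apery_coeff (x # xs) n \<ge> 0" for n
    by (simp add: multiple_harmonic_sum_nonneg)
  have "summable (\<lambda>n. apery_coeff (x # xs) n * 1 ^ n)"
    by (rule summable_apery_coeff) simp
  then have sm: "summable (apery_coeff (x # xs))"
    by (simp only: power_one mult_1_right)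
  have "(apery_coeff (x # xs) has_sum (\<Sum>n. apery_coeff (x # xs) n)) UNIV"
    using sm nn by (intro sums_nonneg_imp_has_sum summable_sums)
  also have "?this \<longleftrightarrow> (apery_coeff (x # xs) has_sum (\<Sum>n. apery_coeff (x # xs) n)) {0<..}"
    by (rule has_sum_cong_neutral) (use assms in auto)
  finally have S: "(apery_coeff (x # xs) has_sum (\<Sum>n. apery_coeff (x # xs) n)) {0<..}" .
  have fibre: "((\<lambda>ns. ?f (n # ns)) has_sum apery_coeff (x # xs) n)
      (decreasing_tuples_below (length xs) n)" for n
  proof -
    have "apery_coeff (x # xs) n = (\<Sum>ns\<in>decreasing_tuples_below (length xs) n. ?f (n # ns))"
      by (simp add: prod_nth_Cons[unfolded length_Cons] multiple_harmonic_sum_eq_sum_tuples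
            sum_divide_distrib mult_ac del: prod.lessThan_Suc)
    then show ?thesis by (simp only: has_sum_finite finite_decreasing_tuples_below)
  qed
  have "((\<lambda>(n, ns). ?f (n # ns)) has_sum (\<Sum>n. apery_coeff (x # xs) n))
          (Sigma {0<..} (decreasing_tuples_below (length xs)))"
  proof (rule has_sum_SigmaI[OF _ S])
    show "(\<lambda>(n, ns). ?f (n # ns)) summable_on Sigma {0<..} (decreasing_tuples_below (length xs))"
    proof (rule summable_on_SigmaI[where g = "apery_coeff (x # xs)"])
      show "apery_coeff (x # xs) summable_on {0<..}" using S by (auto simp: summable_on_def)
      show "(case (n, ns) of (n, ns) \<Rightarrow> ?f (n # ns)) \<ge> 0" for n ns
        unfolding prod.case by (intro mult_nonneg_nonneg prod_nonneg ballI) auto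
    qed (use fibre in simp)
  qed (use fibre in simp)
  then have "(?f has_sum (\<Sum>n. apery_coeff (x # xs) n)) (decreasing_tuples (length (x # xs)))"
    unfolding length_Cons[of x xs] decreasing_tuples_Suc
    by (subst has_sum_reindex) (auto simp only: inj_on_def o_def case_prod_unfold list.sel list.inject prod_eq_iff)
  then show ?thesis
    unfolding binom_sigma_def by (rule infsumI)
qed

section \<open>Generating functions in the angle variable\<close>

text \<open>The argument 2 - 2 cos t is (2 sin(t/2))^2. It equals 1 at t = pi/3, where the series
  becomes the multiple sum, and it stays inside the disc |z| < 2 as long as cos t > 0.\<close>

definition apery_fun :: "nat list \<Rightarrow> real \<Rightarrow> real" where
  "apery_fun xs t = (\<Sum>n. apery_coeff xs n * (2 - 2 * cos t) ^ n)"

definition apery_fun' :: "nat list \<Rightarrow> real \<Rightarrow> real" where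
  "apery_fun' xs t = 2 * sin t * (\<Sum>n. diffs (apery_coeff xs) n * (2 - 2 * cos t) ^ n)"

lemma abs_two_minus_two_cos_less:
  fixes t :: real
  assumes "cos t > 0"
  shows "\<bar>2 - 2 * cos t\<bar> < 2"
  using assms cos_le_one[of t] unfolding abs_less_iff by linarith

lemma summable_diffs_apery_coeff:
  fixes z :: real
  assumes "\<bar>z\<bar> < 2"
  shows "summable (\<lambda>n. diffs (apery_coeff xs) n * z ^ n)"
    and "summable (\<lambda>n. diffs (diffs (apery_coeff xs)) n * z ^ n)"
proof -
  have 1: "summable (\<lambda>n. diffs (apery_coeff xs) n * z ^ n)" if "\<bar>z\<bar> < 2" for z
    by (rule termdiff_converges[of z 2]) (use that summable_apery_coeff in auto)
  show "summable (\<lambda>n. diffs (apery_coeff xs) n * z ^ n)" by (rule 1[OF assms])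
  show "summable (\<lambda>n. diffs (diffs (apery_coeff xs)) n * z ^ n)"
    by (rule termdiff_converges[of z 2]) (use assms 1 in auto)
qed

text \<open>The Euler operator z d/dz, by which differential equations become identities between
  coefficients.\<close>

lemma powser_index_times_sums:
  fixes z :: real
  assumes "summable (\<lambda>n. diffs c n * z ^ n)"
  shows "(\<lambda>n. real n * c n * z ^ n) sums (z * (\<Sum>n. diffs c n * z ^ n))"
proof -
  have "(\<lambda>n. z * (real n * c n * z ^ (n - Suc 0))) sums (z * (\<Sum>n. diffs c n * z ^ n))"
    by (intro sums_mult diffs_equiv assms)
  moreover have "z * (real n * c n * z ^ (n - Suc 0)) = real n * c n * z ^ n" for n
    by (cases n) auto
  ultimately show ?thesis by simp
qed

lemma apery_fun_has_derivative:
  assumes "cos t > 0"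
  shows "(apery_fun xs has_real_derivative apery_fun' xs t) (at t)"
proof -
  have "((\<lambda>z. \<Sum>n. apery_coeff xs n * z ^ n) has_real_derivative
          (\<Sum>n. diffs (apery_coeff xs) n * (2 - 2 * cos t) ^ n)) (at (2 - 2 * cos t))"
    using abs_two_minus_two_cos_less[OF assms] summable_apery_coeff
    by (intro termdiffs_strong'[of 2]) auto
  moreover have "((\<lambda>t. 2 - 2 * cos t) has_real_derivative 2 * sin t) (at t)"
    by (auto intro!: derivative_eq_intros)
  ultimately have "((\<lambda>t. \<Sum>n. apery_coeff xs n * (2 - 2 * cos t) ^ n) has_real_derivative
      (\<Sum>n. diffs (apery_coeff xs) n * (2 - 2 * cos t) ^ n) * (2 * sin t)) (at t)"
    by (rule DERIV_chain2)
  then show ?thesis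
    unfolding apery_fun_def[abs_def] apery_fun'_def by (simp only: mult.commute)
qed

text \<open>The coefficient form of \<open>G\<^sub>n'' = n\<^sup>2 (G\<^sub>n\<^sub>-\<^sub>1 - G\<^sub>n)\<close> for
  \<open>G\<^sub>n(t) = (2 - 2 cos t)\<^sup>n / binom(2n, n)\<close>.\<close>

lemma apery_coeff_2_recurrence:
  assumes "\<forall>x\<in>set xs. x > 0"
  shows "(4 * real n + 2) * diffs (apery_coeff (2 # xs)) n
           - (real n)\<^sup>2 * apery_coeff (2 # xs) n = apery_coeff xs n"
proof -
  let ?C = "\<lambda>n. real ((2 * n) choose n)"
  have C: "?C n > 0" for n by simp
  have "(4 * real n + 2) * diffs (apery_coeff (2 # xs)) n =
      (4 * real n + 2) * (multiple_harmonic_sum xs (Suc n) / (real (Suc n) * ?C (Suc n)))"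
    by (simp add: diffs_def power2_eq_square del: binomial_Suc_Suc)
  also have "\<dots> = multiple_harmonic_sum xs (Suc n) / ?C n"
    unfolding central_binomial_Suc using C[of n] by (simp add: divide_simps)
  finally have 1: "(4 * real n + 2) * diffs (apery_coeff (2 # xs)) n =
      multiple_harmonic_sum xs (Suc n) / ?C n" .
  have 2: "(real n)\<^sup>2 * apery_coeff (2 # xs) n = (if n = 0 then 0 else multiple_harmonic_sum xs n / ?C n)"
    by auto
  \<comment> \<open>For \<open>[]\<close> the two quotients cancel except at \<open>n = 0\<close>,
    which leaves the constant series 1. For a nonempty list the difference of consecutive harmonic
    sums is the next summand.\<close>
  show ?thesis
  proof (cases xs)
    case Nil
    then show ?thesis unfolding 1 2 by auto
  next
    case (Cons x ys)
    then show ?thesis using assms unfolding 1 2 unfolding Cons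
      by (subst multiple_harmonic_sum_Cons_Suc) (auto simp: field_simps)
  qed
qed

text \<open>For f(z) with z = 2 - 2 cos t, the second t-derivative is 2 cos t f' + 4 sin^2 t f''.
  Since 2 cos t = 2 - z and 4 sin^2 t = z (4 - z), this equals 4 z f'' + 2 f' - (z d/dz)^2 f, whose
  coefficients \<open>apery_coeff_2_recurrence\<close> evaluates.\<close>

lemma apery_fun'_2_has_derivative:
  assumes t: "cos t > 0" and xs: "\<forall>x\<in>set xs. x > 0"
  shows "(apery_fun' (2 # xs) has_real_derivative apery_fun xs t) (at t)"
proof -
  define c where "c = apery_coeff (2 # xs)"
  define z where "z = 2 - 2 * cos t"
  define f1 where "f1 = (\<Sum>n. diffs c n * z ^ n)"
  define f2 where "f2 = (\<Sum>n. diffs (diffs c) n * z ^ n)"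
  have z: "\<bar>z\<bar> < 2" unfolding z_def by (rule abs_two_minus_two_cos_less[OF t])
  note s = summable_diffs_apery_coeff[of _ "2 # xs", folded c_def]
  have "((\<lambda>z. \<Sum>n. diffs c n * z ^ n) has_real_derivative f2) (at (2 - 2 * cos t))"
    unfolding f2_def z_def using z s(1)
    by (intro termdiffs_strong'[of 2]) (auto simp: z_def)
  moreover have "((\<lambda>t. 2 - 2 * cos t) has_real_derivative 2 * sin t) (at t)"
    by (auto intro!: derivative_eq_intros)
  ultimately have "((\<lambda>t. \<Sum>n. diffs c n * (2 - 2 * cos t) ^ n) has_real_derivative
      f2 * (2 * sin t)) (at t)"
    by (rule DERIV_chain2)
  then have "((\<lambda>t. 2 * sin t * (\<Sum>n. diffs c n * (2 - 2 * cos t) ^ n)) has_real_derivative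
      2 * cos t * f1 + f2 * (2 * sin t) * (2 * sin t)) (at t)"
    by (auto intro!: derivative_eq_intros simp: f1_def z_def)
  moreover have "2 * cos t * f1 + f2 * (2 * sin t) * (2 * sin t) = apery_fun xs t"
  proof -
    have zf2: "(\<lambda>n. real n * diffs c n * z ^ n) sums (z * f2)"
      unfolding f2_def by (rule powser_index_times_sums[OF s(2)[OF z]])
    have f1: "(\<lambda>n. diffs c n * z ^ n) sums f1"
      unfolding f1_def by (rule summable_sums[OF s(1)[OF z]])
    \<comment> \<open>This builds (z d/dz)^2 f, with coefficients n^2 c_n; the later shift from
      \<open>Suc n\<close> to \<open>n\<close> is harmless because the term at 0 vanishes.\<close>
    have "(\<lambda>n. z * (real n * diffs c n * z ^ n + diffs c n * z ^ n)) sums (z * (z * f2 + f1))"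
      by (intro sums_mult sums_add zf2 f1)
    moreover have "z * (real n * diffs c n * z ^ n + diffs c n * z ^ n) =
        (real (Suc n))\<^sup>2 * c (Suc n) * z ^ Suc n" for n
      by (simp add: diffs_def algebra_simps power2_eq_square)
    ultimately have "(\<lambda>n. (real (Suc n))\<^sup>2 * c (Suc n) * z ^ Suc n) sums (z * (z * f2 + f1))"
      by simp
    then have B: "(\<lambda>n. (real n)\<^sup>2 * c n * z ^ n) sums (z * (z * f2 + f1))"
      by (subst (asm) sums_Suc_iff) simp
    have "(\<lambda>n. 4 * (real n * diffs c n * z ^ n) + 2 * (diffs c n * z ^ n) - (real n)\<^sup>2 * c n * z ^ n)
        sums (4 * (z * f2) + 2 * f1 - z * (z * f2 + f1))"
      by (intro sums_mult sums_add sums_diff zf2 f1 B)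
    moreover have "4 * (real n * diffs c n * z ^ n) + 2 * (diffs c n * z ^ n) - (real n)\<^sup>2 * c n * z ^ n
        = apery_coeff xs n * z ^ n" for n
      unfolding apery_coeff_2_recurrence[OF xs, of n, symmetric, folded c_def]
      by (simp add: algebra_simps)
    ultimately have "apery_fun xs t = 4 * (z * f2) + 2 * f1 - z * (z * f2 + f1)"
      unfolding apery_fun_def z_def[symmetric] by (simp add: sums_iff)
    also have "\<dots> = 2 * cos t * f1 + 4 * (1 - (cos t)\<^sup>2) * f2"
      unfolding z_def by (simp add: algebra_simps power2_eq_square)
    also have "1 - (cos t)\<^sup>2 = (sin t)\<^sup>2" by (simp add: sin_squared_eq)
    finally show ?thesis by (simp add: power2_eq_square mult_ac)
  qed
  ultimately show ?thesis
    unfolding apery_fun'_def[abs_def] c_def by simp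
qed

text \<open>The operator z d/dz lowers the leading exponent by one, and the chain rule contributes 2
  sin t / z = cot(t/2).\<close>

lemma apery_fun_Suc_has_derivative:
  assumes t: "cos t > 0" "sin (t / 2) > 0" and x: "x > 0"
  shows "(apery_fun (Suc x # xs) has_real_derivative cot (t / 2) * apery_fun (x # xs) t) (at t)"
proof -
  define z where "z = 2 - 2 * cos t"
  have z: "\<bar>z\<bar> < 2" unfolding z_def by (rule abs_two_minus_two_cos_less[OF t(1)])
  have "(\<lambda>n. real n * apery_coeff (Suc x # xs) n * z ^ n) sums
      (z * (\<Sum>n. diffs (apery_coeff (Suc x # xs)) n * z ^ n))"
    by (rule powser_index_times_sums[OF summable_diffs_apery_coeff(1)[OF z]])
  \<comment> \<open>At \<open>n = 0\<close> both sides are 0, the right-hand one because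
    \<open>x > 0\<close>.\<close>
  moreover have "real n * apery_coeff (Suc x # xs) n = apery_coeff (x # xs) n" for n
    using x by auto
  ultimately have 1: "apery_fun (x # xs) t = z * (\<Sum>n. diffs (apery_coeff (Suc x # xs)) n * z ^ n)"
    unfolding apery_fun_def z_def[symmetric] by (simp only: sums_iff)
  have c: "cos t = 1 - 2 * (sin (t / 2))\<^sup>2"
    using cos_double_sin[of "t / 2"] by simp
  have s: "sin t = 2 * sin (t / 2) * cos (t / 2)"
    using sin_double[of "t / 2"] by simp
  have "cot (t / 2) * z = 2 * sin t"
    using t(2) unfolding z_def c s cot_def by (simp add: power2_eq_square)
  then have "cot (t / 2) * apery_fun (x # xs) t = apery_fun' (Suc x # xs) t"
    unfolding 1 apery_fun'_def z_def[symmetric] by (simp only: mult.assoc[symmetric])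
  then show ?thesis using apery_fun_has_derivative[OF t(1)] by simp
qed

lemma apery_fun_0: "x > 0 \<Longrightarrow> apery_fun (x # xs) 0 = 0"
  using powser_zero[of "apery_coeff (x # xs)"] by (simp add: apery_fun_def)

lemma apery_fun'_0: "apery_fun' xs 0 = 0"
  by (simp add: apery_fun'_def)

section \<open>Repeated integration from 0\<close>

lemma eq_on_interval_if_same_derivative:
  fixes f g :: "real \<Rightarrow> real"
  assumes "\<And>x. x \<in> {a<..<b} \<Longrightarrow> (f has_real_derivative f' x) (at x)"
    and "\<And>x. x \<in> {a<..<b} \<Longrightarrow> (g has_real_derivative f' x) (at x)"
    and "c \<in> {a<..<b}" "f c = g c" "x \<in> {a<..<b}"
  shows "f x = g x"
proof -
  have "\<exists>d. \<forall>x\<in>{a<..<b}. f x - g x = d"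
  proof (rule has_field_derivative_zero_constant)
    fix x assume "x \<in> {a<..<b}"
    then have "((\<lambda>x. f x - g x) has_real_derivative f' x - f' x) (at x)"
      using assms by (intro DERIV_diff) auto
    then show "((\<lambda>x. f x - g x) has_real_derivative 0) (at x within {a<..<b})"
      by (auto intro: has_field_derivative_at_within)
  qed auto
  then show ?thesis using assms by (metis eq_iff_diff_eq_0)
qed

lemma power_div_fact_has_derivative:
  fixes x :: real
  shows "((\<lambda>x. x ^ Suc n / fact (Suc n)) has_real_derivative x ^ n / fact n) (at x)"
proof -
  have "((\<lambda>x. x ^ Suc n / fact (Suc n)) has_real_derivative real (Suc n) * x ^ n / fact (Suc n)) (at x)"
    using DERIV_cdivide[OF DERIV_pow[of "Suc n" x], of "fact (Suc n)"] by simp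
  moreover have "real (Suc n) * x ^ n / fact (Suc n) = x ^ n / fact n"
    by (simp add: fact_Suc del: of_nat_Suc)
  ultimately show ?thesis by (simp only:)
qed

text \<open>Starting from the constant 1, each further 2 integrates twice, and both the function and
  its first derivative vanish at 0.\<close>

lemma apery_fun_replicate_2:
  assumes "\<bar>t\<bar> < pi / 2"
  shows "apery_fun (replicate n 2) t = t ^ (2 * n) / fact (2 * n)"
  using assms
proof (induction n arbitrary: t)
  case 0
  have "(\<lambda>n. apery_coeff [] n * (2 - 2 * cos t) ^ n) = (\<lambda>n. (if n = 0 then 1 else 0) * (2 - 2 * cos t) ^ n)"
    by auto
  then show ?case using powser_sums_if[of 0 "2 - 2 * cos t"]
    by (simp add: apery_fun_def sums_iff)
next
  case (Suc n)
  have c: "cos x > 0" if "x \<in> {-(pi/2)<..<pi/2}" for x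
    using that by (intro cos_gt_zero_pi) auto
  have 1: "apery_fun' (replicate (Suc n) 2) x = x ^ (2 * n + 1) / fact (2 * n + 1)"
    if "x \<in> {-(pi/2)<..<pi/2}" for x
  proof (rule eq_on_interval_if_same_derivative[where c = 0 and f' = "apery_fun (replicate n 2)"
        and f = "apery_fun' (replicate (Suc n) 2)" and g = "\<lambda>x. x ^ (2 * n + 1) / fact (2 * n + 1)"])
    fix x :: real assume x: "x \<in> {-(pi/2)<..<pi/2}"
    show "(apery_fun' (replicate (Suc n) 2) has_real_derivative apery_fun (replicate n 2) x) (at x)"
      unfolding replicate_Suc by (rule apery_fun'_2_has_derivative) (use c x in auto)
    have "((\<lambda>x. x ^ (2 * n + 1) / fact (2 * n + 1)) has_real_derivative x ^ (2 * n) / fact (2 * n)) (at x)"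
      using power_div_fact_has_derivative[of "2 * n" x] by simp
    then show "((\<lambda>x. x ^ (2 * n + 1) / fact (2 * n + 1)) has_real_derivative
        apery_fun (replicate n 2) x) (at x)"
      using Suc.IH[of x] x by auto
  qed (use that in \<open>auto simp: apery_fun'_0\<close>)
  show ?case
  proof (rule eq_on_interval_if_same_derivative[where c = 0 and f' = "apery_fun' (replicate (Suc n) 2)"
        and f = "apery_fun (replicate (Suc n) 2)" and g = "\<lambda>x. x ^ (2 * Suc n) / fact (2 * Suc n)"])
    fix x :: real assume x: "x \<in> {-(pi/2)<..<pi/2}"
    show "(apery_fun (replicate (Suc n) 2) has_real_derivative apery_fun' (replicate (Suc n) 2) x) (at x)"
      by (rule apery_fun_has_derivative) (use c x in auto)
    have "((\<lambda>x. x ^ (2 * Suc n) / fact (2 * Suc n)) has_real_derivative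
        x ^ (2 * n + 1) / fact (2 * n + 1)) (at x)"
      using power_div_fact_has_derivative[of "2 * n + 1" x] by simp
    then show "((\<lambda>x. x ^ (2 * Suc n) / fact (2 * Suc n)) has_real_derivative
        apery_fun' (replicate (Suc n) 2) x) (at x)"
      using 1[OF x] by simp
  qed (use Suc.prems in \<open>auto simp: apery_fun_0\<close>)
qed

text \<open>Taylor's formula with a moving base point: neighbouring terms cancel and only the
  integrand of the remainder survives. This collapses a repeated integration into a single one with
  kernel (\<theta> - t)^m / m!.\<close>

lemma taylor_sum_has_derivative:
  fixes \<psi> :: "nat \<Rightarrow> real \<Rightarrow> real"
  assumes "\<And>j. j \<le> m \<Longrightarrow> (\<psi> j has_real_derivative \<psi> (Suc j) t) (at t)"
  shows "((\<lambda>t. \<Sum>j\<le>m. (\<theta> - t) ^ j / fact j * \<psi> j t) has_real_derivative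
           (\<theta> - t) ^ m / fact m * \<psi> (Suc m) t) (at t)"
  using assms
proof (induction m)
  case 0
  then show ?case by simp
next
  case (Suc m)
  have "((\<lambda>t. (\<theta> - t) ^ Suc m / fact (Suc m)) has_real_derivative (\<theta> - t) ^ m / fact m * (- 1)) (at t)"
    by (rule DERIV_chain2[OF power_div_fact_has_derivative]) (auto intro!: derivative_eq_intros)
  then have "((\<lambda>t. (\<theta> - t) ^ Suc m / fact (Suc m) * \<psi> (Suc m) t) has_real_derivative
      (\<theta> - t) ^ m / fact m * (- 1) * \<psi> (Suc m) t
        + \<psi> (Suc (Suc m)) t * ((\<theta> - t) ^ Suc m / fact (Suc m))) (at t)"
    using Suc.prems by (intro DERIV_mult) auto
  moreover have "((\<lambda>t. \<Sum>j\<le>m. (\<theta> - t) ^ j / fact j * \<psi> j t) has_real_derivative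
           (\<theta> - t) ^ m / fact m * \<psi> (Suc m) t) (at t)"
    using Suc by auto
  ultimately have "((\<lambda>t. (\<Sum>j\<le>m. (\<theta> - t) ^ j / fact j * \<psi> j t)
        + (\<theta> - t) ^ Suc m / fact (Suc m) * \<psi> (Suc m) t) has_real_derivative
      ((\<theta> - t) ^ m / fact m * \<psi> (Suc m) t + ((\<theta> - t) ^ m / fact m * (- 1) * \<psi> (Suc m) t
        + \<psi> (Suc (Suc m)) t * ((\<theta> - t) ^ Suc m / fact (Suc m))))) (at t)"
    by (intro DERIV_add)
  moreover have "(\<theta> - t) ^ m / fact m * \<psi> (Suc m) t + ((\<theta> - t) ^ m / fact m * (- 1) * \<psi> (Suc m) t
        + \<psi> (Suc (Suc m)) t * ((\<theta> - t) ^ Suc m / fact (Suc m))) =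
      (\<theta> - t) ^ Suc m / fact (Suc m) * \<psi> (Suc (Suc m)) t"
    by (simp only: mult.commute[of "\<psi> (Suc (Suc m)) t"])
  ultimately show ?case by (simp only: sum.atMost_Suc)
qed

text \<open>\<open>K\<close> is the Taylor sum of the first 2a derivatives of the generating
  function, \<open>\<psi> j\<close> being the j-th one; two derivatives strip one leading 2. At
  \<theta> only the term j = 0 remains, and at 0 every term vanishes. Working with \<open>K\<close>
  replaces the integral in the argument by an antiderivative.\<close>

lemma apery_antiderivative_exists:
  fixes \<theta> :: real
  assumes \<theta>: "\<bar>\<theta>\<bar> < pi / 2"
  obtains K where "K \<theta> = apery_fun (replicate a 2 @ [3] @ replicate b 2) \<theta>" "K 0 = 0"
    "\<And>t. \<bar>t\<bar> < pi / 2 \<Longrightarrow> isCont K t"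
    "\<And>t. 0 < t \<Longrightarrow> t < pi / 2 \<Longrightarrow> (K has_real_derivative
       (\<theta> - t) ^ (2 * a) / fact (2 * a) * (t ^ (2 * b + 2) / fact (2 * b + 2)) * cot (t / 2)) (at t)"
proof -
  define ys where "ys = 3 # replicate b (2::nat)"
  define L where "L j = replicate (a - j div 2) 2 @ ys" for j
  define \<psi> where "\<psi> j = (if even j then apery_fun (L j) else apery_fun' (L j))" for j
  define K where "K t = (\<Sum>j\<le>2 * a. (\<theta> - t) ^ j / fact j * \<psi> j t)" for t
  have D: "(\<psi> j has_real_derivative \<psi> (Suc j) t) (at t)" if "j \<le> 2 * a" "cos t > 0" for j t
  proof (cases "even j")
    case True
    then have "L (Suc j) = L j" by (simp add: L_def)
    then show ?thesis using True that by (simp add: \<psi>_def apery_fun_has_derivative)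
  next
    case False
    then have "a - j div 2 = Suc (a - Suc j div 2)" using that by (auto elim!: oddE)
    then have "L j = 2 # L (Suc j)" by (simp add: L_def)
    moreover have "\<forall>x\<in>set (L (Suc j)). x > 0" by (auto simp: L_def ys_def)
    ultimately show ?thesis using False that by (simp add: \<psi>_def apery_fun'_2_has_derivative)
  qed
  have KD: "(K has_real_derivative (\<theta> - t) ^ (2 * a) / fact (2 * a) * apery_fun' ys t) (at t)"
    if "cos t > 0" for t
    using taylor_sum_has_derivative[of "2 * a" \<psi> t \<theta>] D that
    by (simp add: K_def[abs_def] \<psi>_def L_def)
  show ?thesis
  proof
    have "K \<theta> = \<psi> 0 \<theta>"
      unfolding K_def by (subst sum.atMost_shift) simp
    then show "K \<theta> = apery_fun (replicate a 2 @ [3] @ replicate b 2) \<theta>"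
      by (simp add: \<psi>_def L_def ys_def)
    have "\<psi> j 0 = 0" for j
    proof -
      obtain x zs where "L j = x # zs" "x > 0"
        by (cases "a - j div 2") (auto simp: L_def ys_def)
      then show ?thesis by (simp add: \<psi>_def apery_fun_0 apery_fun'_0)
    qed
    then show "K 0 = 0" by (simp add: K_def)
    show "isCont K t" if "\<bar>t\<bar> < pi / 2" for t
      using that by (intro DERIV_isCont[OF KD] cos_gt_zero_pi) auto
    fix t :: real assume t: "0 < t" "t < pi / 2"
    have c: "cos t > 0" using t by (intro cos_gt_zero_pi) auto
    have s: "sin (t / 2) > 0" using t by (intro sin_gt_zero) auto
    have "(apery_fun ys has_real_derivative cot (t / 2) * apery_fun (2 # replicate b 2) t) (at t)"
      using apery_fun_Suc_has_derivative[OF c s, of 2] by (simp add: ys_def numeral_3_eq_3)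
    \<comment> \<open>Lowering the 3 to a 2 leaves a run of b + 1 twos, whose generating function is
      an explicit monomial.\<close>
    then have "apery_fun' ys t = cot (t / 2) * apery_fun (replicate (Suc b) 2) t"
      using DERIV_unique[OF apery_fun_has_derivative[OF c]] by simp
    also have "\<dots> = cot (t / 2) * (t ^ (2 * b + 2) / fact (2 * b + 2))"
      using t by (subst apery_fun_replicate_2) auto
    finally show "(K has_real_derivative (\<theta> - t) ^ (2 * a) / fact (2 * a) *
        (t ^ (2 * b + 2) / fact (2 * b + 2)) * cot (t / 2)) (at t)"
      using KD[OF c] by (simp add: mult_ac)
  qed
qed

section \<open>Derivatives of the weight polynomial\<close>

text \<open>With the factorials built in, differentiating either factor just lowers its exponent,
  with a sign change for the first factor \<theta> - t.\<close>

definition beta_poly :: "real \<Rightarrow> nat \<Rightarrow> nat \<Rightarrow> real poly" where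
  "beta_poly \<theta> A B = smult (1 / fact A) ([:\<theta>, -1:] ^ A) * smult (1 / fact B) ([:0, 1:] ^ B)"

lemma poly_beta_poly: "poly (beta_poly \<theta> A B) t = (\<theta> - t) ^ A / fact A * (t ^ B / fact B)"
  by (simp add: beta_poly_def poly_power)

lemma pderiv_power_div_fact:
  fixes p :: "real poly"
  shows "pderiv (smult (1 / fact (Suc n)) (p ^ Suc n)) = smult (1 / fact n) (p ^ n) * pderiv p"
proof -
  have "1 / fact (Suc n) * real (Suc n) = 1 / fact n"
    by (simp add: fact_Suc del: of_nat_Suc)
  then show ?thesis
    by (simp only: pderiv_smult pderiv_power_Suc mult_smult_left smult_smult)
qed

lemma pderiv_beta_poly:
  "pderiv (beta_poly \<theta> 0 0) = 0"
  "pderiv (beta_poly \<theta> 0 (Suc B)) = beta_poly \<theta> 0 B"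
  "pderiv (beta_poly \<theta> (Suc A) 0) = - beta_poly \<theta> A 0"
  "pderiv (beta_poly \<theta> (Suc A) (Suc B)) = beta_poly \<theta> (Suc A) B - beta_poly \<theta> A (Suc B)"
proof -
  define e where "e A = smult (1 / fact A) ([:\<theta>, -1:] ^ A)" for A
  define x where "x B = smult (1 / fact B) ([:0, 1 :: real:] ^ B)" for B
  have b: "beta_poly \<theta> A B = e A * x B" for A B
    by (simp add: beta_poly_def e_def x_def)
  have 0: "pderiv (e 0) = 0" "pderiv (x 0) = 0"
    by (simp_all add: e_def x_def)
  have "pderiv [:\<theta>, -1:] = - 1" "pderiv [:0, 1 :: real:] = 1"
    by (simp_all add: pderiv_pCons one_pCons)
  then have Suc: "pderiv (e (Suc n)) = - e n" "pderiv (x (Suc n)) = x n" for n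
    unfolding e_def x_def pderiv_power_div_fact by simp_all
  show "pderiv (beta_poly \<theta> 0 0) = 0"
    "pderiv (beta_poly \<theta> 0 (Suc B)) = beta_poly \<theta> 0 B"
    "pderiv (beta_poly \<theta> (Suc A) 0) = - beta_poly \<theta> A 0"
    "pderiv (beta_poly \<theta> (Suc A) (Suc B)) = beta_poly \<theta> (Suc A) B - beta_poly \<theta> A (Suc B)"
    by (simp_all add: b pderiv_mult 0 Suc mult.commute)
qed

lemma higher_pderiv_minus: "(pderiv ^^ j) (- p) = - (pderiv ^^ j) (p :: real poly)"
  using higher_pderiv_smult[of j "-1" p] by simp

lemma higher_pderiv_diff: "(pderiv ^^ j) (p - q) = (pderiv ^^ j) p - (pderiv ^^ j) (q :: real poly)"
  using higher_pderiv_add[of j p "- q"] by (simp add: higher_pderiv_minus)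

lemma higher_pderiv_Suc: "(pderiv ^^ Suc j) p = (pderiv ^^ j) (pderiv p)"
  by (simp only: funpow_Suc_right o_apply)

text \<open>By the Leibniz rule, only the term that spends exactly \<open>A\<close> derivatives on
  (\<theta> - t)^A survives at \<theta>. In the induction this appears as Pascal's rule.\<close>

lemma higher_pderiv_beta_poly_right:
  assumes "j \<le> A + B"
  shows "poly ((pderiv ^^ j) (beta_poly \<theta> A B)) \<theta> =
           (-1) ^ A * real (j choose A) * (\<theta> ^ (A + B - j) / fact (A + B - j))"
  using assms
proof (induction j arbitrary: A B)
  case 0
  then show ?case by (cases A) (auto simp: poly_beta_poly)
next
  case (Suc j)
  show ?case
  proof (cases A; cases B)
    fix A' B' assume "A = Suc A'" "B = Suc B'"
    then show ?thesis using Suc.prems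
      unfolding higher_pderiv_Suc
      by (simp add: pderiv_beta_poly higher_pderiv_diff Suc.IH del: funpow.simps) (simp add: algebra_simps add_divide_distrib)
  next
    fix A' assume "A = Suc A'" "B = 0"
    then show ?thesis using Suc.prems
      unfolding higher_pderiv_Suc
      by (simp add: pderiv_beta_poly higher_pderiv_minus Suc.IH del: funpow.simps)
  qed (use Suc.prems in \<open>simp_all add: higher_pderiv_Suc pderiv_beta_poly Suc.IH del: funpow.simps\<close>)
qed

text \<open>At 0 exactly \<open>B\<close> derivatives must hit t^B; the other j - B each give a
  sign, written as (-1)^(j + B) to avoid truncated subtraction.\<close>

lemma higher_pderiv_beta_poly_0:
  assumes "j \<le> A + B"
  shows "poly ((pderiv ^^ j) (beta_poly \<theta> A B)) 0 =
           (-1) ^ (j + B) * real (j choose B) * (\<theta> ^ (A + B - j) / fact (A + B - j))"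
  using assms
proof (induction j arbitrary: A B)
  case 0
  then show ?case by (cases B) (auto simp: poly_beta_poly)
next
  case (Suc j)
  show ?case
  proof (cases A; cases B)
    fix A' B' assume "A = Suc A'" "B = Suc B'"
    then show ?thesis using Suc.prems
      unfolding higher_pderiv_Suc
      by (simp add: pderiv_beta_poly higher_pderiv_diff Suc.IH del: funpow.simps) (simp add: algebra_simps add_divide_distrib)
  next
    fix A' assume "A = Suc A'" "B = 0"
    then show ?thesis using Suc.prems
      unfolding higher_pderiv_Suc
      by (simp add: pderiv_beta_poly higher_pderiv_minus Suc.IH del: funpow.simps)
  qed (use Suc.prems in \<open>simp_all add: higher_pderiv_Suc pderiv_beta_poly Suc.IH del: funpow.simps\<close>)
qed

lemma higher_pderiv_beta_poly_eq_0:
  assumes "j > A + B"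
  shows "(pderiv ^^ j) (beta_poly \<theta> A B) = 0"
  using assms
proof (induction j arbitrary: A B)
  case (Suc j)
  then show ?case
    by (cases A; cases B)
       (simp_all add: higher_pderiv_Suc pderiv_beta_poly higher_pderiv_diff higher_pderiv_minus Suc.IH
          del: funpow.simps)
qed simp

section \<open>Polylogarithms\<close>

text \<open>The term \<open>n = 0\<close> vanishes for \<open>s \<ge> 1\<close> because \<open>x / 0 = 0\<close>.\<close>

definition polylog :: "nat \<Rightarrow> complex \<Rightarrow> complex" where
  "polylog s z = (\<Sum>n. 1 / of_nat n ^ s * z ^ n)"

lemma summable_polylog:
  fixes z :: complex
  assumes "norm z < 1"
  shows "summable (\<lambda>n. 1 / of_nat n ^ s * z ^ n)"
proof (rule summable_comparison_test')
  show "summable (\<lambda>n. norm z ^ n)" using assms by (simp add: summable_geometric)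
  fix n :: nat
  assume "n \<ge> 1"
  then have "1 / real n ^ s * norm z ^ n \<le> 1 * norm z ^ n"
    by (intro mult_right_mono) (auto simp: divide_simps)
  then show "norm (1 / of_nat n ^ s * z ^ n) \<le> norm z ^ n"
    by (simp add: norm_mult norm_divide norm_power)
qed

lemma polylog_has_derivative:
  assumes z: "norm z < 1" "z \<noteq> 0" and s: "s > 0"
  shows "(polylog (Suc s) has_field_derivative polylog s z / z) (at z)"
proof -
  let ?c = "\<lambda>n. 1 / of_nat n ^ Suc s :: complex"
  have sm: "summable (\<lambda>n. diffs ?c n * z ^ n)"
    by (rule termdiff_converges[OF z(1) summable_polylog])
  have "(\<lambda>n. z * (of_nat n * ?c n * z ^ (n - Suc 0))) sums (z * (\<Sum>n. diffs ?c n * z ^ n))"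
    by (intro sums_mult diffs_equiv sm)
  moreover have "z * (of_nat n * ?c n * z ^ (n - Suc 0)) = 1 / of_nat n ^ s * z ^ n" for n
    using s by (cases n) auto
  ultimately have "polylog s z = z * (\<Sum>n. diffs ?c n * z ^ n)"
    by (simp add: polylog_def sums_iff)
  then have "polylog s z / z = (\<Sum>n. diffs ?c n * z ^ n)"
    using z by simp
  moreover have "((\<lambda>z. \<Sum>n. ?c n * z ^ n) has_field_derivative (\<Sum>n. diffs ?c n * z ^ n)) (at z)"
    by (rule termdiffs_strong'[OF summable_polylog z(1)])
  ultimately show ?thesis
    unfolding polylog_def[abs_def] by simp
qed

text \<open>Along a circle d/dt is i times z d/dz, so the order drops by one. The radius
  \<open>r < 1\<close> keeps the path where the series can be differentiated termwise.\<close>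

lemma polylog_circle_has_derivative:
  assumes r: "0 < r" "r < 1" and s: "s > 0"
  shows "((\<lambda>t. polylog (Suc s) (of_real r * cis t)) has_vector_derivative
           \<i> * polylog s (of_real r * cis t)) (at t)"
proof -
  let ?z = "of_real r * cis t"
  have z: "norm ?z < 1" "?z \<noteq> 0" using r by (auto simp: norm_mult)
  have "((\<lambda>t. of_real r * cis t) has_vector_derivative of_real r * (\<i> * cis t)) (at t)"
    unfolding has_vector_derivative_complex_iff by (auto intro!: derivative_eq_intros)
  from field_vector_diff_chain_at[OF this polylog_has_derivative[OF z s]]
  have "((\<lambda>t. polylog (Suc s) (of_real r * cis t)) has_vector_derivative
      of_real r * (\<i> * cis t) * (polylog s ?z / ?z)) (at t)"
    by (simp add: o_def)
  moreover have "of_real r * (\<i> * cis t) * (polylog s ?z / ?z) = \<i> * polylog s ?z"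
    using z(2) by (simp add: field_simps)
  ultimately show ?thesis by simp
qed

lemma polylog_1:
  assumes "norm z < 1"
  shows "polylog 1 z = - Ln (1 - z)"
proof -
  have "(\<lambda>n. - (- ((- (- z)) ^ n) / of_nat n)) sums (- Ln (1 + - z))"
    by (intro sums_minus Ln_series') (use assms in auto)
  then show ?thesis by (simp add: polylog_def sums_iff)
qed

text \<open>From order 2 on, the series converges uniformly on the closed disc. Order 1 is a
  logarithm singular at 1, so the argument runs at radius r < 1 and passes to the limit only in
  orders at least 2.\<close>

lemma continuous_on_polylog:
  assumes "s \<ge> 2"
  shows "continuous_on (cball 0 1) (polylog s)"
proof (rule uniform_limit_theorem)
  show "uniform_limit (cball 0 1) (\<lambda>N z. \<Sum>n<N. 1 / of_nat n ^ s * z ^ n) (polylog s) sequentially"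
    unfolding polylog_def[abs_def]
  proof (rule Weierstrass_m_test)
    show "summable (\<lambda>n. 1 / real n ^ s)"
      using inverse_power_summable[OF assms, where 'a = real] by (simp add: inverse_eq_divide)
    fix n :: nat and z :: complex
    assume "z \<in> cball 0 1"
    then have "1 / real n ^ s * norm z ^ n \<le> 1 / real n ^ s * 1"
      by (intro mult_left_mono power_le_one) auto
    then show "norm (1 / of_nat n ^ s * z ^ n) \<le> 1 / real n ^ s"
      by (simp add: norm_mult norm_divide norm_power)
  qed
qed (auto intro!: always_eventually continuous_on_sum continuous_on_mult continuous_on_const
      continuous_on_power continuous_on_id simp del: times_divide_eq_left mult_1)

lemma polylog_radial_limit:
  assumes "s \<ge> 2" "norm w \<le> 1"
  shows "((\<lambda>r. polylog s (of_real r * w)) \<longlongrightarrow> polylog s w) (at_left 1)"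
proof -
  have "continuous_on {0..1} (\<lambda>r. polylog s (of_real r * w))"
    by (rule continuous_on_compose2[OF continuous_on_polylog[OF assms(1)]])
       (use assms(2) in \<open>auto intro!: continuous_intros mult_le_one simp: norm_mult\<close>)
  from continuous_on_Icc_at_leftD[OF this] show ?thesis by simp
qed

section \<open>Integration against the cotangent\<close>

text \<open>The result of \<open>N\<close> integrations by parts of p'(t) Li_1(r e^(it)). All orders
  that occur are at least 2, so the formula still makes sense at r = 1.\<close>

definition polylog_primitive :: "nat \<Rightarrow> real poly \<Rightarrow> real \<Rightarrow> real \<Rightarrow> complex" where
  "polylog_primitive N p r t = - (\<Sum>j<N. of_real (poly ((pderiv ^^ Suc j) p) t) * \<i> ^ Suc j
                                    * polylog (Suc (Suc j)) (of_real r * cis t))"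

text \<open>Repeated integration by parts, written as a telescoping sum.\<close>

lemma polylog_primitive_has_derivative:
  assumes r: "0 < r" "r < 1" and N: "(pderiv ^^ Suc N) p = 0"
  shows "(polylog_primitive N p r has_vector_derivative
           of_real (poly (pderiv p) t) * polylog 1 (of_real r * cis t)) (at t)"
proof -
  let ?p = "\<lambda>j t. complex_of_real (poly ((pderiv ^^ j) p) t)"
  let ?L = "\<lambda>s t. polylog s (of_real r * cis t)"
  \<comment> \<open>As i^2 = -1, the two terms of the product rule become a difference of
    consecutive values \<open>v j\<close>.\<close>
  have i_absorb: "a * \<i> ^ Suc j * (\<i> * b) + c = c - a * \<i> ^ j * b" for a b c j
  proof -
    have "a * \<i> ^ Suc j * (\<i> * b) = (\<i> * \<i>) * (a * \<i> ^ j * b)"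
      by (simp only: power_Suc ac_simps)
    then show ?thesis by simp
  qed
  define v where "v j = ?p (Suc j) t * \<i> ^ j * ?L (Suc j) t" for j
  have D: "((\<lambda>t. ?p (Suc j) t * \<i> ^ Suc j * ?L (Suc (Suc j)) t) has_vector_derivative
          v (Suc j) - v j) (at t)" for j
  proof -
    have "((\<lambda>t. poly ((pderiv ^^ Suc j) p) t) has_real_derivative
        poly ((pderiv ^^ Suc (Suc j)) p) t) (at t)"
      using poly_DERIV[of "(pderiv ^^ Suc j) p" t] by simp
    then have "(?p (Suc j) has_vector_derivative ?p (Suc (Suc j)) t) (at t)"
      by (intro has_vector_derivative_of_real)
         (simp add: has_real_derivative_iff_has_vector_derivative)
    then have "((\<lambda>t. ?p (Suc j) t * \<i> ^ Suc j) has_vector_derivative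
        ?p (Suc (Suc j)) t * \<i> ^ Suc j) (at t)"
      by (rule has_vector_derivative_mult_left)
    from has_vector_derivative_mult[OF this polylog_circle_has_derivative[OF r zero_less_Suc]]
    show ?thesis
      by (rule has_vector_derivative_eq_rhs) (unfold v_def i_absorb, rule refl)
  qed
  have "(polylog_primitive N p r has_vector_derivative - (\<Sum>j<N. v (Suc j) - v j)) (at t)"
    unfolding polylog_primitive_def[abs_def]
    by (intro has_vector_derivative_minus has_vector_derivative_sum D)
  also have "- (\<Sum>j<N. v (Suc j) - v j) = v 0 - v N"
    by (subst sum_lessThan_telescope) simp
  also have "v N = 0" using N by (simp add: v_def del: funpow.simps)
  finally show ?thesis by (simp add: v_def)
qed

lemma polylog_primitive_radial_limit:
  "((\<lambda>r. polylog_primitive N p r t) \<longlongrightarrow> polylog_primitive N p 1 t) (at_left 1)"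
  unfolding polylog_primitive_def
  by (intro tendsto_intros)
     (use polylog_radial_limit[of _ "cis t"] in \<open>simp_all\<close>)

section \<open>Estimates for the logarithm near its singularity\<close>

lemma norm_one_minus_cis:
  assumes "0 \<le> t" "t \<le> 2 * pi"
  shows "norm (1 - cis t) = 2 * sin (t / 2)"
proof -
  have "(norm (1 - cis t))\<^sup>2 = 2 - 2 * cos t"
    using sin_cos_squared_add[of t] unfolding cmod_power2 by (simp add: power2_eq_square algebra_simps)
  also have "\<dots> = (2 * sin (t / 2))\<^sup>2"
    using cos_double_sin[of "t / 2"] by (simp add: power2_eq_square)
  finally show ?thesis
    using assms by (subst (asm) power2_eq_iff_nonneg) (auto intro!: sin_ge_zero)
qed

text \<open>The derivative of sin x - x/2 is cos x - 1/2, nonnegative up to pi/3. The bound compares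
  t with the chord 2 sin(t/2) near 0.\<close>

lemma half_le_sin:
  assumes "0 \<le> x" "x \<le> pi / 3"
  shows "x / 2 \<le> sin x"
proof -
  have "sin 0 - 0 / 2 \<le> sin x - x / 2"
  proof (rule DERIV_nonneg_imp_nondecreasing[OF assms(1)])
    fix y assume y: "0 \<le> y" "y \<le> x"
    have "((\<lambda>x. sin x - x / 2) has_real_derivative cos y - 1 / 2) (at y)"
      by (auto intro!: derivative_eq_intros)
    moreover have "cos y \<ge> cos (pi / 3)"
      by (rule cos_monotone_0_pi_le) (use y assms in auto)
    ultimately show "\<exists>d. ((\<lambda>x. sin x - x / 2) has_real_derivative d) (at y) \<and> 0 \<le> d"
      by (auto simp: cos_60)
  qed
  then show ?thesis by simp
qed

text \<open>With w = |1 - e^(it)| and n = |1 - r e^(it)|, the triangle inequality gives n \<le> w +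
  (1 - r), and expanding n^2 gives n \<ge> r w. The factor 1/w in the bound is later absorbed by the
  zero of p' at 0.\<close>

lemma ln_norm_radial_diff:
  assumes r: "1 / 2 \<le> r" "r < 1" and t: "0 < t" "t \<le> pi"
  shows "\<bar>ln (norm (1 - of_real r * cis t)) - ln (2 * sin (t / 2))\<bar> \<le>
           (1 - r) * (1 / (2 * sin (t / 2)) + 2)"
proof -
  define w where "w = 2 * sin (t / 2)"
  define n where "n = norm (1 - of_real r * cis t)"
  have w0: "w > 0" unfolding w_def using t by (auto intro!: sin_gt_zero)
  have w: "norm (1 - cis t) = w" unfolding w_def using t by (intro norm_one_minus_cis) auto
  have "n = norm ((1 - cis t) + of_real (1 - r) * cis t)"
    unfolding n_def by (simp add: algebra_simps)
  also have "\<dots> \<le> w + (1 - r)"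
    using norm_triangle_ineq[of "1 - cis t" "of_real (1 - r) * cis t"] r
    unfolding w norm_mult by (simp del: of_real_diff)
  also have "\<dots> = w * (1 + (1 - r) / w)" using w0 by (simp add: distrib_left)
  finally have up: "n \<le> w * (1 + (1 - r) / w)" .
  have c: "2 * cos t = 2 - w\<^sup>2"
    unfolding w[symmetric] cmod_power2 using sin_cos_squared_add[of t]
    by (simp add: power2_eq_square algebra_simps)
  have "n\<^sup>2 = 1 - r * (2 * cos t) + r\<^sup>2"
    unfolding n_def cmod_power2
    by (simp add: power_mult_distrib sin_squared_eq) (simp add: power2_eq_square algebra_simps)
  then have "n\<^sup>2 = (r * w)\<^sup>2 + (1 - r)\<^sup>2 + r * (1 - r) * w\<^sup>2"
    unfolding c by (simp add: power2_eq_square algebra_simps)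
  moreover have "(1 - r)\<^sup>2 \<ge> 0" "r * (1 - r) * w\<^sup>2 \<ge> 0" using r by auto
  ultimately have "(r * w)\<^sup>2 \<le> n\<^sup>2" by linarith
  then have low: "r * w \<le> n" by (rule power2_le_imp_le) (simp add: n_def)
  have rw: "r * w > 0" using r w0 by simp
  then have n0: "n > 0" using low by linarith
  have "ln n \<le> ln (w * (1 + (1 - r) / w))" using up n0 by simp
  also have "\<dots> = ln w + ln (1 + (1 - r) / w)" using w0 r by (intro ln_mult_pos) (auto intro!: add_pos_pos)
  also have "ln (1 + (1 - r) / w) \<le> (1 - r) / w"
    using w0 r by (intro ln_add_one_self_le_self) auto
  finally have 1: "ln n - ln w \<le> (1 - r) / w" by simp
  have "- ln r = ln (1 / r)" using r by (simp add: ln_div)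
  also have "\<dots> \<le> 1 / r - 1" using r by (intro ln_le_minus_one) auto
  \<comment> \<open>Here \<open>1 / 2 \<le> r\<close> enters: 1/r - 1 = (1 - r)/r.\<close>
  also have "1 / r - 1 \<le> 2 * (1 - r)"
    using r mult_nonneg_nonneg[of "1 - r" "2 * r - 1"] by (simp add: field_simps)
  finally have "ln r \<ge> - (2 * (1 - r))" by simp
  moreover have "ln (r * w) \<le> ln n" using low rw by simp
  moreover have "ln (r * w) = ln r + ln w" using r w0 by (intro ln_mult_pos) auto
  ultimately have 2: "ln n - ln w \<ge> - (2 * (1 - r))" by linarith
  have "(1 - r) / w \<ge> 0" using w0 r by simp
  then show ?thesis using 1 2 r
    unfolding w_def[symmetric] n_def[symmetric] by (simp add: algebra_simps abs_le_iff)
qed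

text \<open>Integrating \<open>p(t) cot(t/2)\<close> by parts against \<open>2 ln(2 sin(t/2))\<close> leaves no boundary term,
  because this logarithm vanishes at \<open>t = \<pi>/3\<close> and \<open>p\<close> has a double zero at \<open>0\<close>. The logarithm is
  then replaced by \<open>ln |1 - r e\<^sup>i\<^sup>t|\<close> with \<open>r < 1\<close>, at the cost of a uniformly small derivative.\<close>

lemma cot_primitive_difference:
  fixes p q :: "real poly"
  defines "\<theta> \<equiv> pi / 3"
  assumes p: "p = [:0, 1:] ^ 2 * q" and N: "(pderiv ^^ Suc N) p = 0"
    and K: "continuous_on {0..\<theta>} K"
    and K': "\<And>t. 0 < t \<Longrightarrow> t < \<theta> \<Longrightarrow> (K has_real_derivative poly p t * cot (t / 2)) (at t)"
  shows "K \<theta> - K 0 = 2 * Re (polylog_primitive N p 1 \<theta> - polylog_primitive N p 1 0)"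
proof -
  have \<theta>: "0 < \<theta>" "\<theta> < 2" using pi_less_4 by (auto simp: \<theta>_def)
  have s0: "sin (t / 2) > 0" if "0 < t" "t \<le> \<theta>" for t
    using that by (intro sin_gt_zero) (auto simp: \<theta>_def)
  have ts: "t \<le> 2 * (2 * sin (t / 2))" if "0 < t" "t \<le> \<theta>" for t
    using half_le_sin[of "t / 2"] that by (simp add: \<theta>_def)
  \<comment> \<open>The double zero of \<open>p\<close> leaves a factor t in p', which compensates
    the bound of order 1/t on the logarithms.\<close>
  have pp: "poly p t = t\<^sup>2 * poly q t" "poly (pderiv p) t = t * (2 * poly q t + t * poly (pderiv q) t)" for t
    by (simp_all add: p pderiv_pCons power2_eq_square algebra_simps)
  have bdd: "\<exists>C. \<forall>t\<in>{0..\<theta>}. \<bar>f t\<bar> \<le> C" if "continuous_on {0..\<theta>} f" for f :: "real \<Rightarrow> real"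
  proof -
    have "bounded (f ` {0..\<theta>})"
      by (intro compact_imp_bounded compact_continuous_image that) auto
    then show ?thesis by (auto simp: bounded_iff)
  qed
  have poly_cont: "continuous_on {0..\<theta>} (poly f)" for f :: "real poly"
    by (intro continuous_intros)
  obtain C1 where C1: "\<And>t. t \<in> {0..\<theta>} \<Longrightarrow> \<bar>poly q t\<bar> \<le> C1"
    using bdd[of "poly q", OF poly_cont] by blast
  obtain C2 where C2: "\<And>t. t \<in> {0..\<theta>} \<Longrightarrow> \<bar>2 * poly q t + t * poly (pderiv q) t\<bar> \<le> C2"
    using bdd[of "\<lambda>t. 2 * poly q t + t * poly (pderiv q) t", OF continuous_on_add[OF
        continuous_on_mult[OF continuous_on_const poly_cont]
        continuous_on_mult[OF continuous_on_id poly_cont]]] by blast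
  have C0: "C1 \<ge> 0" "C2 \<ge> 0" using C1[of 0] C2[of 0] \<theta> by auto
  let ?l = "\<lambda>t. ln (2 * sin (t / 2))"
  \<comment> \<open>Only t = 0 is delicate. There t |ln w| \<le> 2 for w = 2 sin(t/2), so the
    product is at most 2 C1 t in absolute value.\<close>
  have cont_l: "continuous_on {0..\<theta>} (\<lambda>t. poly p t * ?l t)"
    unfolding continuous_on_eq_continuous_within
  proof
    fix t assume t: "t \<in> {0..\<theta>}"
    show "continuous (at t within {0..\<theta>}) (\<lambda>t. poly p t * ?l t)"
    proof (cases "t = 0")
      case False
      then have "isCont (\<lambda>t. poly p t * ?l t) t"
        using s0[of t] t by (intro continuous_intros) auto
      then show ?thesis by (rule continuous_at_imp_continuous_at_within)
    next
      case True
      have "((\<lambda>t. poly p t * ?l t) \<longlongrightarrow> 0) (at 0 within {0..\<theta>})"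
      proof (rule Lim_null_comparison)
        show "((\<lambda>t. 2 * C1 * t) \<longlongrightarrow> 0) (at 0 within {0..\<theta>})"
          by (auto intro!: tendsto_eq_intros)
        have "norm (poly p t * ?l t) \<le> 2 * C1 * t" if t: "t \<in> {0..\<theta>}" "t \<noteq> 0" for t
        proof -
          have t0: "0 < t" using t by auto
          define w where "w = 2 * sin (t / 2)"
          have w: "w > 0" "t \<le> 2 * w" using s0[of t] ts[of t] t t0 by (auto simp: w_def)
          have "sin (t / 2) \<le> sin (pi / 6)"
            using t t0 by (intro sin_monotone_2pi_le) (auto simp: \<theta>_def)
          then have w1: "w \<le> 1" by (simp add: w_def sin_30)
          have "- ln w = ln (1 / w)" using w by (simp add: ln_div)
          also have "\<dots> \<le> 1 / w - 1" using w by (intro ln_le_minus_one) auto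
          finally have "\<bar>ln w\<bar> \<le> 1 / w" using w w1 by simp
          then have "t * \<bar>ln w\<bar> \<le> 2 * w * (1 / w)"
            using w t0 by (intro mult_mono) auto
          then have "t * \<bar>ln w\<bar> \<le> 2" using w by simp
          then have "(t * \<bar>poly q t\<bar>) * (t * \<bar>ln w\<bar>) \<le> (t * C1) * 2"
            using C1[OF t(1)] t0 C0 by (intro mult_mono) auto
          then show ?thesis
            unfolding w_def[symmetric] by (simp add: pp abs_mult power2_eq_square mult_ac)
        qed
        then show "\<forall>\<^sub>F t in at 0 within {0..\<theta>}. norm (poly p t * ?l t) \<le> 2 * C1 * t"
          by (auto simp: eventually_at_filter)
      qed
      then show ?thesis using True by (simp add: continuous_within pp)
    qed
  qed
  define F where "F r t = Re (polylog_primitive N p r t)" for r t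
  have F': "(F r has_real_derivative - (poly (pderiv p) t * ln (norm (1 - of_real r * cis t)))) (at t)"
    if r: "0 < r" "r < 1" for r t
  proof -
    have n: "norm (of_real r * cis t) < 1" using r by (simp add: norm_mult)
    then have "1 - of_real r * cis t \<noteq> 0" by auto
    then have "Re (polylog 1 (of_real r * cis t)) = - ln (norm (1 - of_real r * cis t))"
      unfolding polylog_1[OF n] by (simp add: Re_Ln)
    moreover have "((\<lambda>t. Re (polylog_primitive N p r t)) has_vector_derivative
        Re (of_real (poly (pderiv p) t) * polylog 1 (of_real r * cis t))) (at t)"
      by (rule bounded_linear.has_vector_derivative[OF bounded_linear_Re
            polylog_primitive_has_derivative[OF r N]])
    ultimately show ?thesis
      unfolding F_def[abs_def] has_real_derivative_iff_has_vector_derivative by simp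
  qed
  have bound: "\<bar>(K \<theta> - K 0) - 2 * (F r \<theta> - F r 0)\<bar> \<le> 12 * C2 * (1 - r) * \<theta>"
    if r: "1 / 2 \<le> r" "r < 1" for r
  proof -
    let ?n = "\<lambda>t. ln (norm (1 - of_real r * cis t))"
    \<comment> \<open>In the derivative of \<open>?M\<close> the cotangents cancel, leaving 2 p'
      times the difference of the two logarithms, which is small as r tends to 1.\<close>
    let ?M = "\<lambda>t. K t - 2 * (poly p t * ?l t) - 2 * F r t"
    have r0: "0 < r" using r by simp
    have "\<exists>\<xi>\<in>{0<..<\<theta>}. ?M \<theta> - ?M 0 = (\<lambda>h. 2 * poly (pderiv p) \<xi> * (?n \<xi> - ?l \<xi>) * h) (\<theta> - 0)"
    proof (rule mvt[OF \<theta>(1)])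
      have "continuous_on {0..\<theta>} (F r)"
        by (rule DERIV_continuous_on, rule has_field_derivative_at_within, rule F'[OF r0 r(2)])
      then show "continuous_on {0..\<theta>} ?M"
        using K cont_l by (intro continuous_on_diff continuous_on_mult_left)
      fix t assume t: "0 < t" "t < \<theta>"
      note s = s0[OF t(1) less_imp_le[OF t(2)]]
      have "(?l has_real_derivative cot (t / 2) / 2) (at t)"
        using s by (auto intro!: derivative_eq_intros simp: cot_def)
      then have "(?M has_real_derivative (poly p t * cot (t / 2)
          - 2 * (poly (pderiv p) t * ?l t + cot (t / 2) / 2 * poly p t)
          - 2 * - (poly (pderiv p) t * ?n t))) (at t)"
        by (intro DERIV_diff K'[OF t] DERIV_cmult DERIV_mult poly_DERIV F'[OF r0 r(2)])
      then have "(?M has_real_derivative 2 * poly (pderiv p) t * (?n t - ?l t)) (at t)"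
        by (simp add: algebra_simps)
      then show "(?M has_derivative (\<lambda>h. 2 * poly (pderiv p) t * (?n t - ?l t) * h)) (at t)"
        by (simp add: has_field_derivative_def)
    qed (rule bexI, assumption, simp)
    then obtain \<xi> where \<xi>: "0 < \<xi>" "\<xi> < \<theta>"
      and eq: "?M \<theta> - ?M 0 = 2 * poly (pderiv p) \<xi> * (?n \<xi> - ?l \<xi>) * \<theta>"
      by auto
    define w where "w = 2 * sin (\<xi> / 2)"
    have w: "w > 0" "\<xi> \<le> 2 * w" using s0[of \<xi>] ts[of \<xi>] \<xi> by (auto simp: w_def)
    have "\<bar>?n \<xi> - ?l \<xi>\<bar> \<le> (1 - r) * (1 / w + 2)"
      unfolding w_def using \<xi> by (intro ln_norm_radial_diff r) (auto simp: \<theta>_def)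
    moreover have "\<bar>poly (pderiv p) \<xi>\<bar> \<le> \<xi> * C2"
      using \<xi> C2[of \<xi>] unfolding pp abs_mult by (intro mult_mono) auto
    ultimately have "\<bar>poly (pderiv p) \<xi>\<bar> * \<bar>?n \<xi> - ?l \<xi>\<bar> \<le> (\<xi> * C2) * ((1 - r) * (1 / w + 2))"
      using C0 \<xi> by (intro mult_mono) auto
    also have "\<dots> = (\<xi> * (1 / w) + 2 * \<xi>) * (C2 * (1 - r))"
      by (simp only: distrib_left distrib_right mult_ac)
    \<comment> \<open>The 6 is 2 + 4: \<xi>/w \<le> 2 from the chord estimate, and 2 \<xi> \<le> 4
      from \<theta> < 2.\<close>
    also have "\<dots> \<le> 6 * (C2 * (1 - r))"
    proof (intro mult_right_mono)
      have "\<xi> * (1 / w) \<le> 2" using w by (simp add: field_simps)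
      then show "\<xi> * (1 / w) + 2 * \<xi> \<le> 6" using \<xi> \<theta> by linarith
    qed (use C0 r in auto)
    finally have "2 * (\<bar>poly (pderiv p) \<xi>\<bar> * \<bar>?n \<xi> - ?l \<xi>\<bar>) * \<theta> \<le> 2 * (6 * (C2 * (1 - r))) * \<theta>"
      using \<theta> by (intro mult_right_mono mult_left_mono) auto
    then have "\<bar>?M \<theta> - ?M 0\<bar> \<le> 12 * C2 * (1 - r) * \<theta>"
      unfolding eq using \<theta> by (simp add: abs_mult mult_ac)
    \<comment> \<open>No boundary term survives: 2 sin(pi/6) = 1 at \<theta>, and at 0 the factor
      \<open>p\<close> vanishes whatever value \<open>ln 0\<close> has.\<close>
    moreover have "?l \<theta> = 0" by (simp add: \<theta>_def sin_30)
    moreover have "poly p 0 = 0" by (simp add: pp)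
    ultimately show ?thesis by (simp add: algebra_simps)
  qed
  have "((\<lambda>r. (K \<theta> - K 0) - 2 * (F r \<theta> - F r 0)) \<longlongrightarrow> (K \<theta> - K 0) - 2 * (F 1 \<theta> - F 1 0)) (at_left 1)"
    unfolding F_def by (intro tendsto_intros polylog_primitive_radial_limit)
  moreover have "((\<lambda>r. (K \<theta> - K 0) - 2 * (F r \<theta> - F r 0)) \<longlongrightarrow> 0) (at_left 1)"
  proof (rule Lim_null_comparison)
    show "((\<lambda>r. 12 * C2 * (1 - r) * \<theta>) \<longlongrightarrow> 0) (at_left 1)"
      by (auto intro!: tendsto_eq_intros)
    have "\<forall>\<^sub>F r in at_left 1. r \<in> {1 / 2<..<1 :: real}"
      by (rule eventually_at_leftI[of "1 / 2"]) auto
    then show "\<forall>\<^sub>F r in at_left 1. norm ((K \<theta> - K 0) - 2 * (F r \<theta> - F r 0)) \<le> 12 * C2 * (1 - r) * \<theta>"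
      by eventually_elim (use bound in auto)
  qed
  ultimately have "(K \<theta> - K 0) - 2 * (F 1 \<theta> - F 1 0) = 0"
    by (intro tendsto_unique) auto
  then show ?thesis by (simp add: F_def)
qed

section \<open>Polylogarithms at the sixth root of unity\<close>

lemma zeta_sums:
  assumes "s \<ge> 2"
  shows "(\<lambda>n. 1 / real n ^ s) sums zeta s"
proof -
  have "summable (\<lambda>n. 1 / real n ^ s)"
    using inverse_power_summable[OF assms, where 'a = real] by (simp add: inverse_eq_divide)
  then have "(\<lambda>n. 1 / real (Suc n) ^ s) sums zeta s"
    unfolding zeta_def by (intro summable_sums) (subst summable_Suc_iff)
  then show ?thesis
    using assms by (subst (asm) sums_Suc_iff) (simp add: power_0_left)
qed

lemma dirichlet_L_chi3_sums:
  assumes "s \<ge> 2"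
  shows "(\<lambda>n. chi3 n / real n ^ s) sums dirichlet_L s chi3"
proof -
  have "summable (\<lambda>n. chi3 n / real n ^ s)"
  proof (rule summable_comparison_test')
    show "summable (\<lambda>n. 1 / real n ^ s)" using zeta_sums[OF assms] by (rule sums_summable)
    show "norm (chi3 n / real n ^ s) \<le> 1 / real n ^ s" for n
      by (auto simp: chi3_def)
  qed
  then have "(\<lambda>n. chi3 (Suc n) / real (Suc n) ^ s) sums dirichlet_L s chi3"
    unfolding dirichlet_L_def
    by (intro summable_sums) (subst summable_Suc_iff[of "\<lambda>n. chi3 n / real n ^ s"])
  then show ?thesis
    using assms sums_Suc_iff[of "\<lambda>n. chi3 n / real n ^ s" "dirichlet_L s chi3"]
    by (simp add: power_0_left)
qed

lemma sums_multiples: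
  fixes f :: "nat \<Rightarrow> real"
  assumes "d > 0" "(\<lambda>m. f (d * m)) sums c"
  shows "(\<lambda>n. if d dvd n then f n else 0) sums c"
proof -
  have "(\<lambda>m. if d dvd d * m then f (d * m) else 0) sums c" using assms(2) by simp
  then show ?thesis
    by (subst (asm) sums_mono_reindex[of "\<lambda>m. d * m"])
       (use assms(1) in \<open>auto simp: strict_mono_def dvd_def\<close>)
qed

lemma zeta_multiples_sums:
  assumes "s \<ge> 2" "d > 0"
  shows "(\<lambda>n. if d dvd n then 1 / real n ^ s else 0) sums (zeta s / real d ^ s)"
proof (rule sums_multiples[OF assms(2)])
  have "1 / real (d * n) ^ s = 1 / real n ^ s / real d ^ s" for n
    by (simp add: power_mult_distrib)
  then show "(\<lambda>n. 1 / real (d * n) ^ s) sums (zeta s / real d ^ s)"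
    using sums_divide[OF zeta_sums[OF assms(1)], of "real d ^ s"] by (simp only:)
qed

text \<open>Twice the real part, 2 cos(n pi/3), is the Ramanujan sum c_6(n), hence a combination of
  divisibility indicators for the divisors of 6. The imaginary part is the character up to the
  parity sign. Both are checked over one period of length 6.\<close>

lemma cis_pi_third_power:
  "cis (pi / 3) ^ n =
     Complex ((1 - (if 2 dvd n then 2 else 0) - (if 3 dvd n then 3 else 0) + (if 6 dvd n then 6 else 0)) / 2)
             (sqrt 3 / 2 * (chi3 n * (if 2 dvd n then -1 else 1)))"
proof -
  define v where "v = cis (pi / 3)"
  have v: "Re v = 1 / 2" "Im v = sqrt 3 / 2"
    by (simp_all add: v_def cos_60 sin_60)
  have 2: "v ^ 2 = v - 1"
    by (simp add: complex_eq_iff power2_eq_square v)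
  have 3: "v ^ 3 = - 1"
    unfolding power3_eq_cube by (simp add: complex_eq_iff v)
  have "v ^ 4 = v ^ 3 * v" "v ^ 5 = v ^ 3 * v ^ 2" "v ^ 6 = v ^ 3 * v ^ 3"
    by (simp_all add: eval_nat_numeral)
  then have 456: "v ^ 4 = - v" "v ^ 5 = 1 - v" "v ^ 6 = 1"
    unfolding 2 3 by simp_all
  have "v ^ n = v ^ (6 * (n div 6) + n mod 6)" by simp
  also have "\<dots> = v ^ (n mod 6)"
    unfolding power_add power_mult 456 by simp
  finally have p: "v ^ n = v ^ (n mod 6)" .
  have m3: "n mod 3 = (n mod 6) mod 3" by (simp add: mod_mod_cancel)
  have d: "2 dvd n \<longleftrightarrow> 2 dvd n mod 6" "3 dvd n \<longleftrightarrow> 3 dvd n mod 6" "6 dvd n \<longleftrightarrow> n mod 6 = 0"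
    by presburger+
  consider "n mod 6 = 0" | "n mod 6 = 1" | "n mod 6 = 2" | "n mod 6 = 3" | "n mod 6 = 4" | "n mod 6 = 5"
    by linarith
  then show ?thesis
    unfolding v_def[symmetric] p chi3_def m3 d
    by cases (simp_all only:, simp_all add: v 2 3 456 complex_eq_iff)
qed

lemma polylog_circle_sums:
  assumes "s \<ge> 2" "norm z \<le> 1"
  shows "(\<lambda>n. 1 / of_nat n ^ s * z ^ n) sums polylog s z"
  unfolding polylog_def
proof (rule summable_sums, rule summable_comparison_test')
  show "summable (\<lambda>n. 1 / real n ^ s)" using zeta_sums[OF assms(1)] by (rule sums_summable)
  fix n :: nat
  have "1 / real n ^ s * norm z ^ n \<le> 1 / real n ^ s * 1"
    using assms by (intro mult_left_mono power_le_one) auto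
  then show "norm (1 / of_nat n ^ s * z ^ n) \<le> 1 / real n ^ s"
    by (simp add: norm_mult norm_divide norm_power)
qed

lemma polylog_at_1:
  assumes "s \<ge> 2"
  shows "polylog s 1 = of_real (zeta s)"
proof -
  have "(\<lambda>n. complex_of_real (1 / real n ^ s)) sums of_real (zeta s)"
    by (rule sums_of_real[OF zeta_sums[OF assms]])
  then show ?thesis
    using polylog_circle_sums[OF assms, of 1] by (simp add: sums_iff)
qed

lemma of_nat_power_complex_mult:
  "Re (1 / of_nat n ^ s * z) = Re z / real n ^ s" "Im (1 / of_nat n ^ s * z) = Im z / real n ^ s"
proof -
  have eq: "1 / of_nat n ^ s * z = of_real (1 / real n ^ s) * z" by simp
  show "Re (1 / of_nat n ^ s * z) = Re z / real n ^ s" "Im (1 / of_nat n ^ s * z) = Im z / real n ^ s"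
    unfolding eq by simp_all
qed

text \<open>Multiples of d contribute zeta(s)/d^s, so the indicators for 2, 3 and 6 combine into a
  product of two Euler-type factors.\<close>

lemma Re_polylog_pi_third:
  assumes "s \<ge> 2"
  shows "2 * Re (polylog s (cis (pi / 3))) = (1 - 2 / 2 ^ s) * (1 - 3 / 3 ^ s) * zeta s"
proof -
  let ?g = "\<lambda>d n. if d dvd n then 1 / real n ^ s else 0"
  have "(\<lambda>n. Re (1 / of_nat n ^ s * cis (pi / 3) ^ n)) sums Re (polylog s (cis (pi / 3)))"
    by (intro sums_Re polylog_circle_sums[OF assms]) auto
  then have "(\<lambda>n. 2 * Re (1 / of_nat n ^ s * cis (pi / 3) ^ n)) sums (2 * Re (polylog s (cis (pi / 3))))"
    by (rule sums_mult)
  moreover have "(\<lambda>n. 1 / real n ^ s - 2 * ?g 2 n - 3 * ?g 3 n + 6 * ?g 6 n) sums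
      (zeta s - 2 * (zeta s / real 2 ^ s) - 3 * (zeta s / real 3 ^ s) + 6 * (zeta s / real 6 ^ s))"
    by (intro sums_add sums_diff sums_mult zeta_multiples_sums zeta_sums assms) auto
  moreover have "2 * Re (1 / of_nat n ^ s * cis (pi / 3) ^ n) =
      1 / real n ^ s - 2 * ?g 2 n - 3 * ?g 3 n + 6 * ?g 6 n" for n
    unfolding of_nat_power_complex_mult cis_pi_third_power complex.sel
    by (auto simp: add_divide_distrib diff_divide_distrib)
  ultimately have "2 * Re (polylog s (cis (pi / 3))) =
      zeta s - 2 * (zeta s / real 2 ^ s) - 3 * (zeta s / real 3 ^ s) + 6 * (zeta s / real 6 ^ s)"
    by (simp only: sums_iff)
  also have "real 6 ^ s = 2 ^ s * 3 ^ s" by (simp flip: power_mult_distrib)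
  finally show ?thesis by (simp add: field_simps)
qed

lemma chi3_double: "chi3 (2 * n) = - chi3 n"
proof -
  have "2 * n mod 3 = 2 * (n mod 3) mod 3" by (simp add: mod_mult_right_eq)
  moreover have "n mod 3 = 0 \<or> n mod 3 = 1 \<or> n mod 3 = 2" by linarith
  ultimately show ?thesis by (auto simp: chi3_def)
qed

text \<open>Flipping the sign at even n subtracts the even part twice, and chi(2) = -1 makes that
  part -L/2^s.\<close>

lemma Im_polylog_pi_third:
  assumes "s \<ge> 2"
  shows "2 * Im (polylog s (cis (pi / 3))) = sqrt 3 * (1 + 2 / 2 ^ s) * dirichlet_L s chi3"
proof -
  let ?L = "dirichlet_L s chi3"
  let ?f = "\<lambda>n. chi3 n / real n ^ s"
  let ?g = "\<lambda>n. if 2 dvd n then ?f n else 0"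
  have "(\<lambda>n. Im (1 / of_nat n ^ s * cis (pi / 3) ^ n)) sums Im (polylog s (cis (pi / 3)))"
    by (intro sums_Im polylog_circle_sums[OF assms]) auto
  then have "(\<lambda>n. 2 * Im (1 / of_nat n ^ s * cis (pi / 3) ^ n)) sums (2 * Im (polylog s (cis (pi / 3))))"
    by (rule sums_mult)
  moreover have "?g sums (- ?L / 2 ^ s)"
  proof (rule sums_multiples)
    have "(\<lambda>n. - ?f n / 2 ^ s) sums (- ?L / 2 ^ s)"
      by (intro sums_divide sums_minus dirichlet_L_chi3_sums assms)
    moreover have "?f (2 * n) = - ?f n / 2 ^ s" for n
      by (simp add: chi3_double power_mult_distrib)
    ultimately show "(\<lambda>m. ?f (2 * m)) sums (- ?L / 2 ^ s)" by simp
  qed simp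
  then have "(\<lambda>n. sqrt 3 * (?f n - 2 * ?g n)) sums (sqrt 3 * (?L - 2 * (- ?L / 2 ^ s)))"
    by (intro sums_mult sums_diff dirichlet_L_chi3_sums assms)
  moreover have "2 * Im (1 / of_nat n ^ s * cis (pi / 3) ^ n) = sqrt 3 * (?f n - 2 * ?g n)" for n
    unfolding of_nat_power_complex_mult cis_pi_third_power complex.sel by auto
  ultimately have "2 * Im (polylog s (cis (pi / 3))) = sqrt 3 * (?L - 2 * (- ?L / 2 ^ s))"
    by (simp only: sums_iff)
  then show ?thesis by (simp add: field_simps)
qed

section \<open>Evaluation\<close>

lemma binom_sigma_eq_apery_fun:
  assumes "xs \<noteq> []" "hd xs > 0"
  shows "binom_sigma xs = apery_fun xs (pi / 3)"
proof -
  obtain x ys where xs: "xs = x # ys" using assms(1) by (cases xs) auto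
  have "binom_sigma xs = (\<Sum>n. apery_coeff xs n)"
    unfolding xs by (rule binom_sigma_eq_suminf) (use assms xs in auto)
  then show ?thesis by (simp add: apery_fun_def cos_60)
qed

lemma sum_lessThan_double_Suc:
  fixes g :: "nat \<Rightarrow> real"
  shows "(\<Sum>j<2 * M. g (Suc j)) = (\<Sum>r = 1..M. g (2 * r - 1)) + (\<Sum>r = 1..M. g (2 * r))"
  by (induction M) (simp_all add: sum.atLeast1_atMost_eq)

lemma Re_i_power_mult:
  "Re (of_real c * \<i> ^ (2 * r) * z) = c * (-1) ^ r * Re z"
  "r > 0 \<Longrightarrow> Re (of_real c * \<i> ^ (2 * r - 1) * z) = c * (-1) ^ r * Im z"
proof -
  have e: "\<i> ^ (2 * r) = of_real ((-1) ^ r)" for r by (simp add: power_mult)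
  show "Re (of_real c * \<i> ^ (2 * r) * z) = c * (-1) ^ r * Re z"
    unfolding e of_real_mult[symmetric] by simp
  assume "r > 0"
  then obtain m where m: "r = Suc m" by (cases r) auto
  have "\<i> ^ (2 * r - 1) = \<i> * \<i> ^ (2 * m)" by (simp add: m)
  then have "of_real c * \<i> ^ (2 * r - 1) * z = of_real (c * (-1) ^ m) * (\<i> * z)"
    unfolding e by (simp add: mult_ac)
  then show "Re (of_real c * \<i> ^ (2 * r - 1) * z) = c * (-1) ^ r * Im z"
    by (simp add: m)
qed

text \<open>Powers of i alternate between real and imaginary: odd derivatives of \<open>p\<close>
  meet imaginary parts of even order (L-values at pi/3), even derivatives meet real parts of odd
  order (zeta values).\<close>

lemma Re_polylog_primitive:
  "2 * Re (polylog_primitive (2 * M) p 1 t) =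
     - (\<Sum>r = 1..M. poly ((pderiv ^^ (2 * r - 1)) p) t * (-1) ^ r * (2 * Im (polylog (2 * r) (cis t))))
     - (\<Sum>r = 1..M. poly ((pderiv ^^ (2 * r)) p) t * (-1) ^ r * (2 * Re (polylog (2 * r + 1) (cis t))))"
proof -
  define g where "g j = Re (of_real (poly ((pderiv ^^ j) p) t) * \<i> ^ j * polylog (Suc j) (cis t))" for j
  have "Re (polylog_primitive (2 * M) p 1 t) = - (\<Sum>j<2 * M. g (Suc j))"
    by (simp add: polylog_primitive_def g_def del: funpow.simps power_Suc)
  also have "\<dots> = - (\<Sum>r = 1..M. g (2 * r - 1)) - (\<Sum>r = 1..M. g (2 * r))"
    unfolding sum_lessThan_double_Suc by simp
  also have "(\<Sum>r = 1..M. g (2 * r - 1)) =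
      (\<Sum>r = 1..M. poly ((pderiv ^^ (2 * r - 1)) p) t * (-1) ^ r * Im (polylog (2 * r) (cis t)))"
  proof (intro sum.cong refl)
    fix r assume "r \<in> {1..M}"
    then have "r > 0" "Suc (2 * r - 1) = 2 * r" by auto
    then show "g (2 * r - 1) = poly ((pderiv ^^ (2 * r - 1)) p) t * (-1) ^ r * Im (polylog (2 * r) (cis t))"
      by (simp only: g_def Re_i_power_mult(2))
  qed
  also have "(\<Sum>r = 1..M. g (2 * r)) =
      (\<Sum>r = 1..M. poly ((pderiv ^^ (2 * r)) p) t * (-1) ^ r * Re (polylog (2 * r + 1) (cis t)))"
    by (intro sum.cong refl) (simp only: g_def Re_i_power_mult(1) Suc_eq_plus1)
  finally show ?thesis
    by (simp add: sum_distrib_left mult_ac)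
qed

theorem theorem6:
  fixes a b k :: nat
  assumes "k = 2 * a + 2 * b + 3"
  shows "binom_sigma (replicate a 2 @ [3] @ replicate b 2) =
      - (\<Sum>r = max a 1..a + b + 1.
           real ((2 * r) choose (2 * a)) * ((pi / 3) ^ (k - 1 - 2 * r) / fact (k - 1 - 2 * r))
           * (-1) ^ r * (1 - 2 powi (- 2 * int r)) * (1 - 3 powi (- 2 * int r)) * zeta (2 * r + 1))
      - (\<Sum>r = a + 1..a + b + 1.
           real ((2 * r - 1) choose (2 * a)) * ((pi / 3) ^ (k - 2 * r) / fact (k - 2 * r))
           * (-1) ^ r * sqrt 3 * (1 + 2 powi (1 - 2 * int r)) * dirichlet_L (2 * r) chi3)
      + (\<Sum>r = b + 1..a + b + 1.
           real ((2 * r) choose (2 * b + 2)) * ((pi / 3) ^ (k - 1 - 2 * r) / fact (k - 1 - 2 * r))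
           * (2 * (-1) ^ r) * zeta (2 * r + 1))"
    (is "_ = - sum ?A _ - sum ?B _ + sum ?C _")
proof -
  define \<theta> :: real where "\<theta> = pi / 3"
  \<comment> \<open>2M is the degree of the weight polynomial, so 2M integrations by parts exhaust
    it.\<close>
  define M where "M = a + b + 1"
  define p where "p = beta_poly \<theta> (2 * a) (2 * b + 2)"
  have k: "2 * a + (2 * b + 2) = 2 * M" "k - 1 = 2 * M" by (simp_all add: M_def assms)
  have D\<theta>: "poly ((pderiv ^^ i) p) \<theta> =
      real (i choose (2 * a)) * ((pi / 3) ^ (2 * M - i) / fact (2 * M - i))" if "i \<le> 2 * M" for i
    using higher_pderiv_beta_poly_right[of i "2 * a" "2 * b + 2" \<theta>, unfolded k(1)] that
    by (simp add: p_def \<theta>_def)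
  have D0: "poly ((pderiv ^^ i) p) 0 =
      (-1) ^ i * real (i choose (2 * b + 2)) * ((pi / 3) ^ (2 * M - i) / fact (2 * M - i))"
    if "i \<le> 2 * M" for i
    using higher_pderiv_beta_poly_0[of i "2 * a" "2 * b + 2" \<theta>, unfolded k(1)] that
    by (simp add: p_def \<theta>_def power_add)
  let ?xs = "replicate a 2 @ [3] @ replicate b 2"
  have \<theta>: "\<bar>\<theta>\<bar> < pi / 2" by (simp add: \<theta>_def)
  obtain K where K: "K \<theta> = apery_fun ?xs \<theta>" "K 0 = 0"
    "\<And>t. \<bar>t\<bar> < pi / 2 \<Longrightarrow> isCont K t"
    "\<And>t. 0 < t \<Longrightarrow> t < pi / 2 \<Longrightarrow> (K has_real_derivative
       (\<theta> - t) ^ (2 * a) / fact (2 * a) * (t ^ (2 * b + 2) / fact (2 * b + 2)) * cot (t / 2)) (at t)"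
    using apery_antiderivative_exists[OF \<theta>, of a b] by blast
  have "binom_sigma ?xs = apery_fun ?xs \<theta>"
    unfolding \<theta>_def by (rule binom_sigma_eq_apery_fun) (cases a; simp)+
  also have "\<dots> = K \<theta> - K 0" by (simp add: K)
  also have "\<dots> = 2 * Re (polylog_primitive (2 * M) p 1 \<theta> - polylog_primitive (2 * M) p 1 0)"
    unfolding \<theta>_def
  proof (rule cot_primitive_difference)
    \<comment> \<open>The exponent 2b + 2 of t is at least 2, which is the required double
      zero.\<close>
    have "[:0, 1:] ^ 2 dvd p"
      unfolding p_def beta_poly_def by (intro dvd_mult dvd_smult le_imp_power_dvd) simp
    then show "p = [:0, 1:] ^ 2 * (p div [:0, 1:] ^ 2)" by simp
    show "(pderiv ^^ Suc (2 * M)) p = 0"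
      unfolding p_def by (rule higher_pderiv_beta_poly_eq_0) (simp add: M_def)
    have less: "t < pi / 2" if "t \<le> pi / 3" for t :: real
      using that pi_gt_zero by linarith
    show "continuous_on {0..pi / 3} K"
      by (intro continuous_at_imp_continuous_on ballI K(3)) (use less in auto)
    show "(K has_real_derivative poly p t * cot (t / 2)) (at t)" if "0 < t" "t < pi / 3" for t
      using K(4)[OF _ less] that by (simp add: p_def poly_beta_poly)
  qed
  also have "\<dots> = - sum ?A {1..M} - sum ?B {1..M} + sum ?C {1..M}"
  proof -
    \<comment> \<open>The endpoint \<theta> yields the first two sums of the formula; the endpoint 0
      enters with a minus sign and yields the third.\<close>
    have "2 * Re (polylog_primitive (2 * M) p 1 \<theta>) = - sum ?B {1..M} - sum ?A {1..M}"
      unfolding Re_polylog_primitive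
    proof (intro arg_cong2[of _ _ _ _ "(-)"] arg_cong[of _ _ uminus] sum.cong refl)
      fix r assume r: "r \<in> {1..M}"
      have "2 powi (1 - 2 * int r) = 2 / (2 :: real) ^ (2 * r)"
        using power_int_diff[of "2 :: real" 1 "2 * int r"] power_int_of_nat[of "2 :: real" "2 * r"] by simp
      then have "2 * Im (polylog (2 * r) (cis \<theta>)) =
          sqrt 3 * (1 + 2 powi (1 - 2 * int r)) * dirichlet_L (2 * r) chi3"
        using r Im_polylog_pi_third[of "2 * r"] by (simp add: \<theta>_def)
      moreover have "2 * r - 1 \<le> 2 * M" "2 * M - (2 * r - 1) = k - 2 * r" using r k by auto
      ultimately show "poly ((pderiv ^^ (2 * r - 1)) p) \<theta> * (-1) ^ r * (2 * Im (polylog (2 * r) (cis \<theta>))) = ?B r"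
        by (simp only: D\<theta> mult_ac)
    next
      fix r assume r: "r \<in> {1..M}"
      have "x powi (- 2 * int r) = 1 / x ^ (2 * r)" for x :: real
        using power_int_minus[of x "2 * int r"] power_int_of_nat[of x "2 * r"]
        by (simp add: inverse_eq_divide)
      then have "2 * Re (polylog (2 * r + 1) (cis \<theta>)) =
          (1 - 2 powi (- 2 * int r)) * (1 - 3 powi (- 2 * int r)) * zeta (2 * r + 1)"
        using r Re_polylog_pi_third[of "2 * r + 1"] by (simp add: \<theta>_def)
      moreover have "2 * r \<le> 2 * M" using r by simp
      ultimately show "poly ((pderiv ^^ (2 * r)) p) \<theta> * (-1) ^ r * (2 * Re (polylog (2 * r + 1) (cis \<theta>))) = ?A r"
        by (simp only: D\<theta> k(2) mult_ac)
    qed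
    moreover have "2 * Re (polylog_primitive (2 * M) p 1 0) = - sum ?C {1..M}"
    proof -
      \<comment> \<open>At t = 0 the polylogarithms are evaluated at 1 and are real, so no L-values
        arise.\<close>
      have Im: "(\<Sum>r = 1..M. poly ((pderiv ^^ (2 * r - 1)) p) 0 * (-1) ^ r
          * (2 * Im (polylog (2 * r) (cis 0)))) = 0"
      proof (intro sum.neutral ballI)
        fix r assume "r \<in> {1..M}"
        then show "poly ((pderiv ^^ (2 * r - 1)) p) 0 * (-1) ^ r * (2 * Im (polylog (2 * r) (cis 0))) = 0"
          using polylog_at_1[of "2 * r"] by simp
      qed
      have Re: "(\<Sum>r = 1..M. poly ((pderiv ^^ (2 * r)) p) 0 * (-1) ^ r
          * (2 * Re (polylog (2 * r + 1) (cis 0)))) = sum ?C {1..M}"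
      proof (intro sum.cong refl)
        fix r assume r: "r \<in> {1..M}"
        have "2 * Re (polylog (2 * r + 1) (cis 0)) = 2 * zeta (2 * r + 1)"
          using r polylog_at_1[of "2 * r + 1"] by simp
        moreover have "2 * r \<le> 2 * M" "(-1) ^ (2 * r) = (1 :: real)" using r by simp_all
        ultimately show "poly ((pderiv ^^ (2 * r)) p) 0 * (-1) ^ r
            * (2 * Re (polylog (2 * r + 1) (cis 0))) = ?C r"
          by (simp only: D0 k(2) mult_1_left mult_ac)
      qed
      show ?thesis unfolding Re_polylog_primitive Im Re by simp
    qed
    ultimately show ?thesis by (simp add: right_diff_distrib)
  qed
  \<comment> \<open>The remaining summands vanish because the lower entry of their binomial
    coefficient exceeds the upper one.\<close>
  also have "sum ?A {1..M} = sum ?A {max a 1..a + b + 1}"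
    by (rule sum.mono_neutral_right) (auto simp: M_def binomial_eq_0)
  also have "sum ?B {1..M} = sum ?B {a + 1..a + b + 1}"
    by (rule sum.mono_neutral_right) (auto simp: M_def binomial_eq_0)
  also have "sum ?C {1..M} = sum ?C {b + 1..a + b + 1}"
    by (rule sum.mono_neutral_right) (auto simp: M_def binomial_eq_0)
  finally show ?thesis .
qed

end
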